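(* Let $0<s\le 1$ and $s\le r\le 1$. Let $m,n\in\mathbb{N}$ and let $\Phi: M_m(\mathbb{C})\to M_n(\mathbb{C})$ be any sesquiunital Schwarz map. Then for all $A\in M_n^{+}(\mathbb{C})$ and all $B\in M_m(\mathbb{C})$, $$\operatorname{Tr}\left[\left(\Phi(B)^*A^s\,\Phi(B)\right)^{r/s}\right]\le \left(\frac{n}{m}\right)^{1-r}\operatorname{Tr}\left[\left(B^*\Phi^\dagger(A)^sB\right)^{r/s}\right].$$
   Context: $M_n(\mathbb{C})$ denotes the $n\times n$ complex matrices and $M_n^{+}(\mathbb{C})$ the closed cone of positive semidefinite matrices in $M_n(\mathbb{C})$; $\mathbf{1}$ is the identity matrix. Each $M_n(\mathbb{C})$ carries the Hilbert–Schmidt inner product $\langle X,Y\rangle=\operatorname{Tr}[X^*Y]$, and $\Phi^\dagger: M_n(\mathbb{C})\to M_m(\mathbb{C})$ is the adjoint of $\Phi$ with respect to these inner products. A Schwarz map is a linear map $\Phi: M_m(\mathbb{C})\to M_n(\mathbb{C})$ such that $\Phi(X^*X)\ge \Phi(X)^*\Phi(X)$ for all $X\in M_m(\mathbb{C})$. A linear map $\Phi: M_m(\mathbb{C})\to M_n(\mathbb{C})$ is unital if $\Phi(\mathbf{1})=\mathbf{1}$, semiunital if $\Phi^\dagger(\mathbf{1})=\frac{n}{m}\mathbf{1}$, and sesquiunital if it is both unital and semiunital. *)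

theory Defs
  imports "HOL-Analysis.Analysis"
begin

text \<open>
  Complex \<open>n \<times> n\<close> matrices are rendered as \<^typ>\<open>complex ^ 'n ^ 'n\<close>, the dimension being
  \<open>CARD('n)\<close>, which is automatically positive.
\<close>

definition conj_transpose :: "complex ^ 'n ^ 'm \<Rightarrow> complex ^ 'm ^ 'n"
  where "conj_transpose A = map_matrix cnj (transpose A)"

definition matrix_scale :: "complex \<Rightarrow> complex ^ 'n ^ 'm \<Rightarrow> complex ^ 'n ^ 'm"
  where "matrix_scale c A = map_matrix ((*) c) A"

definition cinner :: "complex ^ 'n \<Rightarrow> complex ^ 'n \<Rightarrow> complex"
  where "cinner v w = (\<Sum>i\<in>UNIV. cnj (v $ i) * w $ i)"

text \<open>Membership in \<open>\<real>\<^sub>\<ge>\<^sub>0\<close> includes that the complex number is real; over the complex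
  field this forces the matrix to be Hermitian.\<close>

definition psd :: "complex ^ 'n ^ 'n \<Rightarrow> bool"
  where "psd A \<longleftrightarrow> (\<forall>v. cinner v (A *v v) \<in> \<real>\<^sub>\<ge>\<^sub>0)"

definition loewner_le :: "complex ^ 'n ^ 'n \<Rightarrow> complex ^ 'n ^ 'n \<Rightarrow> bool"  (infix \<open>\<le>\<^sub>L\<close> 50)
  where "A \<le>\<^sub>L B \<longleftrightarrow> psd (B - A)"

definition unitary :: "complex ^ 'n ^ 'n \<Rightarrow> bool"
  where "unitary U \<longleftrightarrow> conj_transpose U ** U = mat 1 \<and> U ** conj_transpose U = mat 1"

definition real_diag :: "('n \<Rightarrow> real) \<Rightarrow> complex ^ 'n ^ 'n"
  where "real_diag d = (\<chi> i j. if i = j then complex_of_real (d i) else 0)"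

text \<open>
  Real powers of a positive semidefinite matrix by the spectral functional calculus. The value
  does not depend on the diagonalization, see \<open>psd_powr_eqI\<close>. Meant for exponents \<open>p > 0\<close>, where
  \<^term>\<open>(0::real) powr p = 0\<close> is the right convention on the kernel; the value is
  unspecified when \<open>A\<close> is not positive semidefinite.
\<close>

definition psd_powr :: "complex ^ 'n ^ 'n \<Rightarrow> real \<Rightarrow> complex ^ 'n ^ 'n"
  where "psd_powr A p =
    (THE X. \<exists>U d. unitary U \<and> (\<forall>i. d i \<ge> 0) \<and>
       A = U ** real_diag d ** conj_transpose U \<and>
       X = U ** real_diag (\<lambda>i. d i powr p) ** conj_transpose U)"

definition hs_inner :: "complex ^ 'n ^ 'n \<Rightarrow> complex ^ 'n ^ 'n \<Rightarrow> complex"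
  where "hs_inner X Y = trace (conj_transpose X ** Y)"

text \<open>The Hilbert--Schmidt adjoint; it exists and is unique for complex-linear \<open>\<Phi>\<close>,
  see \<open>hs_adjoint_works\<close> and \<open>hs_adjoint_unique\<close>.\<close>

definition hs_adjoint ::
    "(complex ^ 'm ^ 'm \<Rightarrow> complex ^ 'n ^ 'n) \<Rightarrow> complex ^ 'n ^ 'n \<Rightarrow> complex ^ 'm ^ 'm"
  where "hs_adjoint \<Phi> = (THE \<Psi>. \<forall>X Y. hs_inner (\<Phi> X) Y = hs_inner X (\<Psi> Y))"

text \<open>The library's \<^const>\<open>linear\<close> is only real-linearity, hence the explicit complex scaling.\<close>

definition clinear_map :: "(complex ^ 'm ^ 'm \<Rightarrow> complex ^ 'n ^ 'n) \<Rightarrow> bool"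
  where "clinear_map \<Phi> \<longleftrightarrow> Vector_Spaces.linear matrix_scale matrix_scale \<Phi>"

definition schwarz_map :: "(complex ^ 'm ^ 'm \<Rightarrow> complex ^ 'n ^ 'n) \<Rightarrow> bool"
  where "schwarz_map \<Phi> \<longleftrightarrow> clinear_map \<Phi> \<and>
    (\<forall>X. conj_transpose (\<Phi> X) ** \<Phi> X \<le>\<^sub>L \<Phi> (conj_transpose X ** X))"

definition unital_map :: "(complex ^ 'm ^ 'm \<Rightarrow> complex ^ 'n ^ 'n) \<Rightarrow> bool"
  where "unital_map \<Phi> \<longleftrightarrow> \<Phi> (mat 1) = mat 1"

definition semiunital_map :: "(complex ^ 'm ^ 'm \<Rightarrow> complex ^ 'n ^ 'n) \<Rightarrow> bool"
  where "semiunital_map \<Phi> \<longleftrightarrow>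
    hs_adjoint \<Phi> (mat 1) = matrix_scale (of_nat CARD('n) / of_nat CARD('m)) (mat 1)"

definition sesquiunital_map :: "(complex ^ 'm ^ 'm \<Rightarrow> complex ^ 'n ^ 'n) \<Rightarrow> bool"
  where "sesquiunital_map \<Phi> \<longleftrightarrow> unital_map \<Phi> \<and> semiunital_map \<Phi>"

lemma vector_space_matrix_scale:
  "vector_space (matrix_scale :: complex \<Rightarrow> complex ^ 'n ^ 'm \<Rightarrow> complex ^ 'n ^ 'm)"
  by unfold_locales (simp_all add: matrix_scale_def vec_eq_iff algebra_simps)

lemma clinear_map_iff:
  "clinear_map \<Phi> \<longleftrightarrow> (\<forall>X Y. \<Phi> (X + Y) = \<Phi> X + \<Phi> Y) \<and>
     (\<forall>c X. \<Phi> (matrix_scale c X) = matrix_scale c (\<Phi> X))"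
  unfolding clinear_map_def
  by (auto simp: Vector_Spaces.linear_iff vector_space_matrix_scale)

lemma hs_inner_eq: "hs_inner X Y = (\<Sum>i\<in>UNIV. \<Sum>j\<in>UNIV. cnj (X $ i $ j) * Y $ i $ j)"
  unfolding hs_inner_def trace_def conj_transpose_def transpose_def
  by (subst sum.swap) (simp add: matrix_matrix_mult_def)

lemma hs_inner_eqD:
  assumes "\<And>X. hs_inner X Y = hs_inner X Z"
  shows "Y = Z"
proof -
  have "Y $ i $ j = Z $ i $ j" for i j
  proof -
    define E :: "complex ^ 'a ^ 'a" where "E = (\<chi> k l. if k = i then if l = j then 1 else 0 else 0)"
    have "hs_inner E W = W $ i $ j" for W
    proof -
      have "cnj (E $ k $ l) * W $ k $ l = (if k = i then if l = j then W $ k $ l else 0 else 0)" for k l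
        by (simp add: E_def)
      then have "hs_inner E W = (\<Sum>k\<in>UNIV. if k = i then \<Sum>l\<in>UNIV. if l = j then W $ k $ l else 0 else 0)"
        unfolding hs_inner_eq by (intro sum.cong refl) auto
      then show ?thesis by simp
    qed
    then show ?thesis using assms[of E] by simp
  qed
  then show ?thesis by (simp add: vec_eq_iff)
qed

lemma ex_hs_adjoint:
  fixes \<Phi> :: "complex ^ 'm ^ 'm \<Rightarrow> complex ^ 'n ^ 'n"
  assumes "clinear_map \<Phi>"
  shows "\<exists>\<Psi>. \<forall>X Y. hs_inner (\<Phi> X) Y = hs_inner X (\<Psi> Y)"
proof -
  define E :: "'m \<Rightarrow> 'm \<Rightarrow> complex ^ 'm ^ 'm"
    where "E i j = (\<chi> k l. if k = i then if l = j then 1 else 0 else 0)" for i j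
  have add: "\<Phi> (X + Y) = \<Phi> X + \<Phi> Y" and scale: "\<Phi> (matrix_scale c X) = matrix_scale c (\<Phi> X)"
    for X Y c using assms by (auto simp: clinear_map_iff)
  have zero: "\<Phi> 0 = 0" using add[of 0 0] by simp
  have sum: "\<Phi> (sum f A) = (\<Sum>a\<in>A. \<Phi> (f a))" if "finite A"
    for f and A :: "'m set" using that by induction (simp_all add: zero add)
  have dec: "X = (\<Sum>i\<in>UNIV. \<Sum>j\<in>UNIV. matrix_scale (X $ i $ j) (E i j))" for X
  proof -
    have "(\<Sum>i\<in>UNIV. \<Sum>j\<in>UNIV. matrix_scale (X $ i $ j) (E i j)) $ k $ l = X $ k $ l" for k l
    proof -
      have "(\<Sum>i\<in>UNIV. \<Sum>j\<in>UNIV. matrix_scale (X $ i $ j) (E i j)) $ k $ l =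
          (\<Sum>i\<in>UNIV. if i = k then (\<Sum>j\<in>UNIV. if j = l then X $ i $ j else 0) else 0)"
      proof -
        have "matrix_scale (X $ i $ j) (E i j) $ k $ l =
            (if i = k then if j = l then X $ i $ j else 0 else 0)" for i j
          by (simp add: matrix_scale_def E_def)
        then show ?thesis
          unfolding sum_component by (intro sum.cong refl) auto
      qed
      then show ?thesis by simp
    qed
    then show ?thesis by (simp add: vec_eq_iff)
  qed
  have in_add: "hs_inner (X + X') Y = hs_inner X Y + hs_inner X' Y" for X X' Y :: "complex ^ 'n ^ 'n"
    by (simp add: hs_inner_eq algebra_simps sum.distrib)
  have in_scale: "hs_inner (matrix_scale c X) Y = cnj c * hs_inner X Y" for c and X Y :: "complex ^ 'n ^ 'n"
    by (simp add: hs_inner_eq matrix_scale_def sum_distrib_left mult.assoc)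
  have in_zero: "hs_inner 0 Y = 0" for Y :: "complex ^ 'n ^ 'n"
    by (simp add: hs_inner_eq)
  have in_sum: "hs_inner (sum f A) Y = (\<Sum>a\<in>A. hs_inner (f a) Y)" if "finite A"
    for f and A :: "'m set" and Y :: "complex ^ 'n ^ 'n"
    using that by induction (simp_all add: in_zero in_add)
  have "hs_inner (\<Phi> X) Y = hs_inner X (\<chi> i j. hs_inner (\<Phi> (E i j)) Y)" for X Y
    by (subst dec[of X]) (simp add: sum scale in_sum in_scale, simp add: hs_inner_eq[of X])
  then show ?thesis
    by (intro exI[of _ "\<lambda>Y. \<chi> i j. hs_inner (\<Phi> (E i j)) Y"]) blast
qed

lemma hs_adjoint_unique:
  assumes "\<And>X Y. hs_inner (\<Phi> X) Y = hs_inner X (\<Psi> Y)"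
  shows "hs_adjoint \<Phi> = \<Psi>"
  unfolding hs_adjoint_def
proof (rule the_equality)
  show "\<forall>X Y. hs_inner (\<Phi> X) Y = hs_inner X (\<Psi> Y)" using assms by blast
next
  fix \<Psi>' assume "\<forall>X Y. hs_inner (\<Phi> X) Y = hs_inner X (\<Psi>' Y)"
  then have "hs_inner X (\<Psi>' Y) = hs_inner X (\<Psi> Y)" for X Y using assms by metis
  then show "\<Psi>' = \<Psi>" using hs_inner_eqD by blast
qed

lemma hs_adjoint_works:
  assumes "clinear_map \<Phi>"
  shows "hs_inner (\<Phi> X) Y = hs_inner X (hs_adjoint \<Phi> Y)"
  using ex_hs_adjoint[OF assms] hs_adjoint_unique by metis

lemma real_diag_mult_left: "(real_diag d ** A) $ i $ j = complex_of_real (d i) * A $ i $ j"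
proof -
  have "(real_diag d ** A) $ i $ j = (\<Sum>k\<in>UNIV. if k = i then complex_of_real (d k) * A $ k $ j else 0)"
    unfolding matrix_matrix_mult_def real_diag_def vec_lambda_beta by (intro sum.cong) auto
  then show ?thesis by simp
qed

lemma real_diag_mult_right: "(A ** real_diag d) $ i $ j = A $ i $ j * complex_of_real (d j)"
proof -
  have "(A ** real_diag d) $ i $ j = (\<Sum>k\<in>UNIV. if k = j then A $ i $ k * complex_of_real (d k) else 0)"
    unfolding matrix_matrix_mult_def real_diag_def vec_lambda_beta by (intro sum.cong) auto
  then show ?thesis by simp
qed

lemma psd_powr_eqI:
  assumes "unitary U" "\<forall>i. d i \<ge> 0" "A = U ** real_diag d ** conj_transpose U"
  shows "psd_powr A p = U ** real_diag (\<lambda>i. d i powr p) ** conj_transpose U"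
  unfolding psd_powr_def
proof (rule the_equality)
  show "\<exists>U' d'. unitary U' \<and> (\<forall>i. d' i \<ge> 0) \<and> A = U' ** real_diag d' ** conj_transpose U' \<and>
      U ** real_diag (\<lambda>i. d i powr p) ** conj_transpose U =
      U' ** real_diag (\<lambda>i. d' i powr p) ** conj_transpose U'"
    using assms by blast
next
  fix X
  assume "\<exists>V e. unitary V \<and> (\<forall>i. e i \<ge> 0) \<and> A = V ** real_diag e ** conj_transpose V \<and>
      X = V ** real_diag (\<lambda>i. e i powr p) ** conj_transpose V"
  then obtain V e where V: "unitary V" and A: "A = V ** real_diag e ** conj_transpose V"
    and X: "X = V ** real_diag (\<lambda>i. e i powr p) ** conj_transpose V" by blast
  let ?W = "conj_transpose V ** U"
  have un: "conj_transpose U ** U = mat 1" "U ** conj_transpose U = mat 1"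
    "conj_transpose V ** V = mat 1" "V ** conj_transpose V = mat 1"
    using assms(1) V by (auto simp: unitary_def)
  have "?W ** real_diag d = conj_transpose V ** A ** U"
    unfolding assms(3) by (metis matrix_mul_assoc matrix_mul_rid un(1))
  also have "\<dots> = real_diag e ** ?W"
    unfolding A by (metis matrix_mul_assoc matrix_mul_lid un(3))
  finally have eq: "?W ** real_diag d = real_diag e ** ?W" .
  have "?W $ i $ j = 0 \<or> d j = e i" for i j
    using arg_cong[OF eq, of "\<lambda>M. M $ i $ j"]
    by (auto simp: real_diag_mult_left real_diag_mult_right)
  then have W: "?W ** real_diag (\<lambda>i. d i powr p) = real_diag (\<lambda>i. e i powr p) ** ?W"
    by (auto simp: vec_eq_iff real_diag_mult_left real_diag_mult_right) (metis mult.commute mult_zero_right)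
  have "X = V ** (real_diag (\<lambda>i. e i powr p) ** ?W) ** conj_transpose U"
    unfolding X by (metis matrix_mul_assoc matrix_mul_rid un(2))
  also have "\<dots> = U ** real_diag (\<lambda>i. d i powr p) ** conj_transpose U"
    unfolding W[symmetric] by (metis matrix_mul_assoc matrix_mul_lid un(4))
  finally show "X = U ** real_diag (\<lambda>i. d i powr p) ** conj_transpose U" .
qed

end

theory Submission
  imports Defs
begin

text \<open>
  Let \<open>\<kappa> = n / m\<close>, \<open>p = r / s \<ge> 1\<close>, \<open>X = \<Phi>(B)\<^sup>* A\<^sup>s \<Phi>(B)\<close> and \<open>Z = B\<^sup>* \<Phi>\<^sup>\<dagger>(A)\<^sup>s B\<close>. The claim compares
  \<open>Tr X\<^sup>p\<close> with \<open>Tr Z\<^sup>p\<close>. Duality linearizes the power: for \<open>p > 1\<close> put \<open>C = X\<^bsup>(p-1)/(1-s)\<^esup>\<close>, so that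
  \<open>Tr X\<^sup>p = Tr [C\<^bsup>1-s\<^esup> \<Phi>(B)\<^sup>* A\<^sup>s \<Phi>(B)]\<close>. Two facts about \<open>\<Phi>\<close> then give the result.

  \<^item> Monotonicity of Lieb's functional (\<open>lieb_monotonicity\<close>):
    \<open>Tr [C\<^bsup>1-s\<^esup> \<Phi>(B)\<^sup>* A\<^sup>s \<Phi>(B)] \<le> Tr [\<Phi>\<^sup>\<dagger>(C)\<^bsup>1-s\<^esup> B\<^sup>* \<Phi>\<^sup>\<dagger>(A)\<^sup>s B]\<close>.
    At the endpoints \<open>s = 0\<close> and \<open>s = 1\<close> this is the Schwarz inequality, for \<open>B\<close> and for \<open>B\<^sup>*\<close>. In
    eigenbases of \<open>A\<close>, \<open>C\<close>, \<open>\<Phi>\<^sup>\<dagger>(A)\<close> and \<open>\<Phi>\<^sup>\<dagger>(C)\<close> all the quantities are weighted \<open>\<ell>\<^sup>2\<close> norms, and the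
    intermediate \<open>s\<close> follow from interpolation between weighted \<open>\<ell>\<^sup>2\<close> spaces
    (\<open>quadratic_interpolation\<close>).

  \<^item> A trace Jensen inequality (\<open>trace_powr_adjoint_le\<close>): \<open>\<Phi>\<^sup>\<dagger> / \<kappa>\<close> is positive and unital, hence
    \<open>Tr \<Phi>\<^sup>\<dagger>(C)\<^sup>t \<le> \<kappa>\<^bsup>t-1\<^esup> Tr C\<^sup>t\<close> for \<open>t \<ge> 1\<close>.

  Let \<open>q\<close> be the exponent conjugate to \<open>p\<close> and \<open>t = (1 - s) q\<close>; the choice of \<open>C\<close> makes
  \<open>Tr C\<^sup>t = Tr X\<^sup>p\<close>. Young's inequality under the trace (\<open>trace_young\<close>), with the two factors rescaled
  by a suitable power of \<open>\<kappa>\<close>, combines these facts to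
  \<open>Tr X\<^sup>p \<le> Tr X\<^sup>p / q + \<kappa>\<^bsup>1-r\<^esup> Tr Z\<^sup>p / p\<close>, which is the claim since \<open>1 - 1/q = 1/p\<close>. For \<open>p = 1\<close>
  the choice \<open>C = 1\<close> suffices.
\<close>

section \<open>Scalar inequalities and interpolation of weighted quadratic norms\<close>

text \<open>
  Jensen's inequality for \<open>x\<^sup>t\<close> with weights of total mass \<open>k\<close>. It is proved from Young's inequality, that is
  from the tangent of \<open>x\<^sup>t\<close> at the mean \<open>\<mu>\<close>, because \<open>c\<^sub>j\<close> and \<open>\<mu>\<close> may vanish.
\<close>

lemma powr_weighted_sum_le:
  fixes P c :: "'a \<Rightarrow> real"
  assumes P: "\<And>j. j \<in> I \<Longrightarrow> P j \<ge> 0" and c: "\<And>j. j \<in> I \<Longrightarrow> c j \<ge> 0"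
    and k: "sum P I = k" "k > 0" and t: "t \<ge> 1"
  shows "(\<Sum>j\<in>I. P j * c j) powr t \<le> k powr (t - 1) * (\<Sum>j\<in>I. P j * c j powr t)"
proof (cases "t = 1")
  case True
  have "(\<Sum>j\<in>I. P j * c j) \<ge> 0" using P c by (intro sum_nonneg) auto
  then show ?thesis using True k c by simp
next
  case False
  then have t1: "t > 1" using t by simp
  define g where "g = (\<Sum>j\<in>I. P j * c j)"
  define \<mu> where "\<mu> = g / k"
  have g: "g \<ge> 0" unfolding g_def using P c by (intro sum_nonneg) auto
  have \<mu>: "\<mu> \<ge> 0" using g k by (simp add: \<mu>_def)
  have "g * \<mu> powr (t - 1) = (\<Sum>j\<in>I. P j * (c j * \<mu> powr (t - 1)))"
    by (simp add: g_def sum_distrib_right mult.assoc)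
  also have "\<dots> \<le> (\<Sum>j\<in>I. P j * (c j powr t / t + \<mu> powr t / (t / (t - 1))))"
  proof (intro sum_mono mult_left_mono P)
    fix j assume j: "j \<in> I"
    have "c j * \<mu> powr (t - 1) \<le> c j powr t / t + (\<mu> powr (t - 1)) powr (t / (t - 1)) / (t / (t - 1))"
      using t1 c[OF j] by (intro Youngs_inequality) (auto simp: field_simps)
    then show "c j * \<mu> powr (t - 1) \<le> c j powr t / t + \<mu> powr t / (t / (t - 1))"
      using t1 by (simp add: powr_powr)
  qed
  also have "\<dots> = (\<Sum>j\<in>I. P j * c j powr t) / t + k * (\<mu> powr t / (t / (t - 1)))"
    by (simp add: distrib_left sum.distrib sum_divide_distrib k(1)[symmetric] sum_distrib_right)
  also have "g * \<mu> powr (t - 1) = k * \<mu> powr t"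
    using k g \<mu> t1 by (cases "\<mu> = 0") (auto simp: \<mu>_def powr_diff)
  finally have "k * \<mu> powr t \<le> (\<Sum>j\<in>I. P j * c j powr t)"
    using t1 by (simp add: field_simps)
  then have "k powr (t - 1) * (k * \<mu> powr t) \<le> k powr (t - 1) * (\<Sum>j\<in>I. P j * c j powr t)"
    by (intro mult_left_mono) auto
  also have "k powr (t - 1) * (k * \<mu> powr t) = g powr t"
    using k g by (simp add: \<mu>_def powr_divide powr_diff)
  finally show ?thesis by (simp add: g_def)
qed

text \<open>
  The harmonic combination \<open>g h / (g + h)\<close> is the parallel sum of the quadratic forms \<open>g |u|\<^sup>2\<close> and \<open>h |v|\<^sup>2\<close>,
  that is their infimal convolution: it bounds the cost of every splitting \<open>u + v\<close> from below, and the next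
  lemma shows that some splitting attains it. When \<open>g = h = 0\<close> the convention \<open>0 / 0 = 0\<close> gives the right value.
\<close>

lemma parallel_sum_le:
  fixes u v :: complex
  assumes "g \<ge> 0" "h \<ge> 0"
  shows "g * h / (g + h) * (cmod (u + v))\<^sup>2 \<le> g * (cmod u)\<^sup>2 + h * (cmod v)\<^sup>2"
proof (cases "g + h = 0")
  case False
  then have pos: "g + h > 0" using assms by simp
  have "g * h * (cmod (u + v))\<^sup>2 \<le> g * h * (cmod u + cmod v)\<^sup>2"
    using assms by (intro mult_left_mono power_mono norm_triangle_ineq) auto
  also have "\<dots> \<le> g * h * (cmod u + cmod v)\<^sup>2 + (g * cmod u - h * cmod v)\<^sup>2" by simp
  also have "\<dots> = (g + h) * (g * (cmod u)\<^sup>2 + h * (cmod v)\<^sup>2)"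
    by (simp add: algebra_simps power2_eq_square)
  finally show ?thesis using pos by (simp add: divide_simps mult_ac)
qed (use assms in auto)

lemma parallel_sum_attained:
  fixes z :: complex
  assumes "g \<ge> 0" "h \<ge> 0"
  shows "\<exists>v. g * (cmod (z - v))\<^sup>2 + h * (cmod v)\<^sup>2 = g * h / (g + h) * (cmod z)\<^sup>2"
proof (cases "g + h = 0")
  case True
  then have "g = 0" "h = 0" using assms by auto
  then show ?thesis by simp
next
  case False
  then have pos: "g + h > 0" using assms by simp
  define v where "v = complex_of_real (g / (g + h)) * z"
  have "z - v = complex_of_real (h / (g + h)) * z"
  proof -
    have "h / (g + h) = 1 - g / (g + h)" using pos by (simp add: field_simps)
    then show ?thesis by (simp only: v_def of_real_diff of_real_1 left_diff_distrib mult_1)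
  qed
  then have "cmod (z - v) = h / (g + h) * cmod z"
    using assms pos by (simp add: norm_mult del: of_real_divide)
  moreover have "cmod v = g / (g + h) * cmod z"
    using assms pos by (simp add: v_def norm_mult del: of_real_divide)
  moreover have "g * (h / (g + h) * w)\<^sup>2 + h * (g / (g + h) * w)\<^sup>2 = g * h / (g + h) * w\<^sup>2" for w
  proof -
    have "g * (h / (g + h) * w)\<^sup>2 + h * (g / (g + h) * w)\<^sup>2 = g * h * (g + h) / (g + h)\<^sup>2 * w\<^sup>2"
      by (simp add: power_mult_distrib power_divide add_divide_distrib algebra_simps power2_eq_square)
    then show ?thesis using pos by (simp add: power2_eq_square)
  qed
  ultimately show ?thesis by metis
qed

text \<open>
  This number is \<open>\<pi> / sin (\<pi> s)\<close>; it enters as a common factor that cancels, for which it has to be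
  finite and nonzero.
\<close>

definition stieltjes_const :: "real \<Rightarrow> ennreal"
  where "stieltjes_const s = (\<integral>\<^sup>+x. indicator {0<..} x * ennreal (x powr (- s) / (1 + x)) \<partial>lborel)"

lemma stieltjes_const_finite:
  assumes "0 < s" "s < 1"
  shows "stieltjes_const s \<noteq> \<infinity>"
proof -
  have i1: "(\<integral>\<^sup>+x. ennreal (x powr (- s)) * indicator {0..1} x \<partial>lborel)
      = ennreal (1 powr (- s + 1) / (- s + 1))"
    using assms by (intro nn_integral_has_integral_lebesgue' has_integral_powr_from_0) auto
  have i2: "(\<integral>\<^sup>+x. ennreal (x powr (- s - 1)) * indicator {1..} x \<partial>lborel)
      = ennreal (- (1 powr (- s - 1 + 1)) / (- s - 1 + 1))"
    using assms by (intro nn_integral_has_integral_lebesgue' has_integral_powr_to_inf) auto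
  have "stieltjes_const s \<le> (\<integral>\<^sup>+x. ennreal (x powr (- s)) * indicator {0..1} x
      + ennreal (x powr (- s - 1)) * indicator {1..} x \<partial>lborel)"
    unfolding stieltjes_const_def
  proof (intro nn_integral_mono)
    fix x :: real
    have "x powr (- s) / (1 + x) \<le> x powr (- s)" if "x > 0"
      using that frac_le[of "x powr (- s)" "x powr (- s)" 1 "1 + x"] by simp
    moreover have "x powr (- s) / (1 + x) \<le> x powr (- s - 1)" if "x > 0"
      using that by (simp add: powr_diff frac_le)
    ultimately show "indicator {0<..} x * ennreal (x powr (- s) / (1 + x))
        \<le> ennreal (x powr (- s)) * indicator {0..1} x + ennreal (x powr (- s - 1)) * indicator {1..} x"
      using add_increasing2[of "ennreal (x powr (- s - 1))" "ennreal (x powr (- s) / (1 + x))" "ennreal (x powr (- s))"]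
      by (auto simp: indicator_def intro!: ennreal_leI)
  qed
  also have "\<dots> = ennreal (1 powr (- s + 1) / (- s + 1)) + ennreal (- (1 powr (- s - 1 + 1)) / (- s - 1 + 1))"
    using i1 i2 by (subst nn_integral_add) auto
  also have "\<dots> < \<infinity>" by simp
  finally show ?thesis by simp
qed

lemma stieltjes_const_nonzero:
  assumes "0 < s"
  shows "stieltjes_const s \<noteq> 0"
proof -
  have "ennreal (2 powr (- s) / 3) = (\<integral>\<^sup>+x. ennreal (2 powr (- s) / 3) * indicator {1..2::real} x \<partial>lborel)"
    by (subst nn_integral_cmult) auto
  also have "\<dots> \<le> stieltjes_const s"
    unfolding stieltjes_const_def
  proof (intro nn_integral_mono)
    fix x :: real
    have "2 powr (- s) / 3 \<le> x powr (- s) / (1 + x)" if "1 \<le> x" "x \<le> 2"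
      using that assms by (intro frac_le powr_mono2') auto
    then show "ennreal (2 powr (- s) / 3) * indicator {1..2} x
        \<le> indicator {0<..} x * ennreal (x powr (- s) / (1 + x))"
      by (auto simp: indicator_def intro!: ennreal_leI)
  qed
  finally show ?thesis by auto
qed

text \<open>
  The weighted geometric mean as an integral of parallel sums. For \<open>g, a > 0\<close> the substitution
  \<open>x = (g / a) y\<close> turns the integrand into the one defining \<^const>\<open>stieltjes_const\<close>.
\<close>

lemma stieltjes_integral:
  fixes g a :: real
  assumes s: "0 < s" "s < 1" and "g \<ge> 0" "a \<ge> 0"
  shows "(\<integral>\<^sup>+x. indicator {0<..} x * ennreal (x powr (- s - 1) * (g * (x * a) / (g + x * a))) \<partial>lborel)
    = ennreal (a powr s * g powr (1 - s)) * stieltjes_const s"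
proof (cases "g = 0 \<or> a = 0")
  case True
  then show ?thesis by auto
next
  case False
  then have pos: "g > 0" "a > 0" using assms by auto
  define c where "c = g / a"
  have c: "c > 0" using pos by (simp add: c_def)
  have "(\<integral>\<^sup>+x. indicator {0<..} x * ennreal (x powr (- s - 1) * (g * (x * a) / (g + x * a))) \<partial>lborel)
     = ennreal \<bar>c\<bar> * (\<integral>\<^sup>+x. indicator {0<..} (0 + c * x) *
         ennreal ((0 + c * x) powr (- s - 1) * (g * ((0 + c * x) * a) / (g + (0 + c * x) * a))) \<partial>lborel)"
    using c by (intro nn_integral_real_affine) auto
  also have "\<dots> = ennreal \<bar>c\<bar> * (\<integral>\<^sup>+x. ennreal (c powr (- s) * a) *
      (indicator {0<..} x * ennreal (x powr (- s) / (1 + x))) \<partial>lborel)"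
  proof (rule arg_cong[where f = "\<lambda>I. ennreal \<bar>c\<bar> * I"], rule nn_integral_cong)
    fix x :: real
    show "indicator {0<..} (0 + c * x) *
         ennreal ((0 + c * x) powr (- s - 1) * (g * ((0 + c * x) * a) / (g + (0 + c * x) * a)))
       = ennreal (c powr (- s) * a) * (indicator {0<..} x * ennreal (x powr (- s) / (1 + x)))"
    proof (cases "x > 0")
      case True
      have "g = c * a" using pos by (simp add: c_def)
      then have "g * (c * x * a) / (g + c * x * a) = (c * a) * (c * x * a) / ((c * a) * (1 + x))"
        by (simp add: algebra_simps)
      then have "g * (c * x * a) / (g + c * x * a) = c * x * a / (1 + x)"
        using c pos by simp
      moreover have "(c * x) powr (- s - 1) = c powr (- s) * x powr (- s) / (c * x)"
        using c True by (simp add: powr_diff powr_mult)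
      ultimately have "(c * x) powr (- s - 1) * (g * (c * x * a) / (g + c * x * a))
          = c powr (- s) * a * (x powr (- s) / (1 + x))"
        using c True by simp
      then show ?thesis
        using c True pos by (simp add: indicator_def ennreal_mult[symmetric])
    next
      case False
      then show ?thesis using c by (simp add: indicator_def zero_less_mult_iff)
    qed
  qed
  also have "\<dots> = ennreal \<bar>c\<bar> * (ennreal (c powr (- s) * a) * stieltjes_const s)"
    unfolding stieltjes_const_def by (subst nn_integral_cmult) auto
  also have "\<dots> = ennreal (c * (c powr (- s) * a)) * stieltjes_const s"
    using c pos by (simp add: ennreal_mult mult.assoc)
  also have "c * (c powr (- s) * a) = a powr s * g powr (1 - s)"
    using pos by (simp add: c_def powr_divide powr_diff powr_minus field_simps)
  finally show ?thesis .
qed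

text \<open>
  Exact interpolation between weighted \<open>\<ell>\<^sup>2\<close> spaces. For fixed \<open>l > 0\<close> split \<open>x = u + v\<close> optimally for the
  weights \<open>\<gamma>\<close> and \<open>l \<alpha>\<close>, bound \<open>T u\<close> by the first hypothesis and \<open>T v\<close> by the second, and recombine with
  \<open>parallel_sum_le\<close>: this is monotonicity of the quadratic K-functional. Integrating against
  \<open>l\<^bsup>-s-1\<^esup> dl\<close> turns the parallel sums into geometric means.
\<close>

theorem quadratic_interpolation:
  fixes T :: "('k::finite \<Rightarrow> complex) \<Rightarrow> 'l::finite \<Rightarrow> complex"
    and a c :: "'l \<Rightarrow> real" and \<alpha> \<gamma> :: "'k \<Rightarrow> real"
  assumes s: "0 < s" "s < 1"
    and add: "\<And>x y i. T (\<lambda>k. x k + y k) i = T x i + T y i"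
    and nonneg: "\<And>i. a i \<ge> 0" "\<And>i. c i \<ge> 0" "\<And>k. \<alpha> k \<ge> 0" "\<And>k. \<gamma> k \<ge> 0"
    and bound0: "\<And>x. (\<Sum>i\<in>UNIV. c i * (cmod (T x i))\<^sup>2) \<le> (\<Sum>k\<in>UNIV. \<gamma> k * (cmod (x k))\<^sup>2)"
    and bound1: "\<And>x. (\<Sum>i\<in>UNIV. a i * (cmod (T x i))\<^sup>2) \<le> (\<Sum>k\<in>UNIV. \<alpha> k * (cmod (x k))\<^sup>2)"
  shows "(\<Sum>i\<in>UNIV. a i powr s * c i powr (1 - s) * (cmod (T x i))\<^sup>2)
    \<le> (\<Sum>k\<in>UNIV. \<alpha> k powr s * \<gamma> k powr (1 - s) * (cmod (x k))\<^sup>2)"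
proof -
  have pointwise: "(\<Sum>i\<in>UNIV. c i * (l * a i) / (c i + l * a i) * (cmod (T x i))\<^sup>2)
      \<le> (\<Sum>k\<in>UNIV. \<gamma> k * (l * \<alpha> k) / (\<gamma> k + l * \<alpha> k) * (cmod (x k))\<^sup>2)" if l: "l > 0" for l
  proof -
    have "\<forall>k. \<exists>v. \<gamma> k * (cmod (x k - v))\<^sup>2 + l * \<alpha> k * (cmod v)\<^sup>2
        = \<gamma> k * (l * \<alpha> k) / (\<gamma> k + l * \<alpha> k) * (cmod (x k))\<^sup>2"
      using nonneg l by (intro allI parallel_sum_attained) auto
    then obtain v where v: "\<And>k. \<gamma> k * (cmod (x k - v k))\<^sup>2 + l * \<alpha> k * (cmod (v k))\<^sup>2
        = \<gamma> k * (l * \<alpha> k) / (\<gamma> k + l * \<alpha> k) * (cmod (x k))\<^sup>2"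
      by metis
    define u where "u = (\<lambda>k. x k - v k)"
    have split: "T x i = T u i + T v i" for i
      using add[of u v i] by (simp add: u_def)
    have "(\<Sum>i\<in>UNIV. c i * (l * a i) / (c i + l * a i) * (cmod (T x i))\<^sup>2)
        \<le> (\<Sum>i\<in>UNIV. c i * (cmod (T u i))\<^sup>2 + l * a i * (cmod (T v i))\<^sup>2)"
      unfolding split using nonneg l by (intro sum_mono parallel_sum_le) auto
    also have "\<dots> = (\<Sum>i\<in>UNIV. c i * (cmod (T u i))\<^sup>2) + l * (\<Sum>i\<in>UNIV. a i * (cmod (T v i))\<^sup>2)"
      by (simp add: sum.distrib sum_distrib_left mult.assoc)
    also have "\<dots> \<le> (\<Sum>k\<in>UNIV. \<gamma> k * (cmod (u k))\<^sup>2) + l * (\<Sum>k\<in>UNIV. \<alpha> k * (cmod (v k))\<^sup>2)"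
      using l bound0[of u] bound1[of v] by (intro add_mono mult_left_mono) auto
    also have "\<dots> = (\<Sum>k\<in>UNIV. \<gamma> k * (cmod (x k - v k))\<^sup>2 + l * \<alpha> k * (cmod (v k))\<^sup>2)"
      by (simp add: sum.distrib sum_distrib_left mult.assoc u_def)
    finally show ?thesis by (simp only: v)
  qed
  have integral: "(\<integral>\<^sup>+l. indicator {0<..} l * ennreal (l powr (- s - 1) *
        (\<Sum>i\<in>UNIV. g i * (l * b i) / (g i + l * b i) * w i)) \<partial>lborel)
      = ennreal (\<Sum>i\<in>UNIV. b i powr s * g i powr (1 - s) * w i) * stieltjes_const s"
    if nn: "\<And>i. g i \<ge> 0" "\<And>i. b i \<ge> 0" "\<And>i. w i \<ge> 0" for g b w :: "'i::finite \<Rightarrow> real"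
  proof -
    have "indicator {0<..} l * ennreal (l powr (- s - 1) *
        (\<Sum>i\<in>UNIV. g i * (l * b i) / (g i + l * b i) * w i))
       = (\<Sum>i\<in>UNIV. ennreal (w i) *
          (indicator {0<..} l * ennreal (l powr (- s - 1) * (g i * (l * b i) / (g i + l * b i)))))" for l
    proof (cases "l > 0")
      case True
      have "ennreal (l powr (- s - 1) * (\<Sum>i\<in>UNIV. g i * (l * b i) / (g i + l * b i) * w i))
        = ennreal (\<Sum>i\<in>UNIV. w i * (l powr (- s - 1) * (g i * (l * b i) / (g i + l * b i))))"
        by (simp add: sum_distrib_left mult_ac)
      also have "\<dots> = (\<Sum>i\<in>UNIV. ennreal (w i * (l powr (- s - 1) * (g i * (l * b i) / (g i + l * b i)))))"
        using nn True by (intro sum_ennreal[symmetric]) auto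
      also have "\<dots> = (\<Sum>i\<in>UNIV. ennreal (w i) * ennreal (l powr (- s - 1) * (g i * (l * b i) / (g i + l * b i))))"
        using nn True by (intro sum.cong refl ennreal_mult) auto
      finally show ?thesis using True by simp
    qed simp
    then have "(\<integral>\<^sup>+l. indicator {0<..} l * ennreal (l powr (- s - 1) *
        (\<Sum>i\<in>UNIV. g i * (l * b i) / (g i + l * b i) * w i)) \<partial>lborel)
      = (\<Sum>i\<in>UNIV. (\<integral>\<^sup>+l. ennreal (w i) *
          (indicator {0<..} l * ennreal (l powr (- s - 1) * (g i * (l * b i) / (g i + l * b i)))) \<partial>lborel))"
      by (simp only:) (rule nn_integral_sum, simp)
    also have "\<dots> = (\<Sum>i\<in>UNIV. ennreal (w i) * (ennreal (b i powr s * g i powr (1 - s)) * stieltjes_const s))"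
      using s nn by (intro sum.cong refl) (subst nn_integral_cmult, measurable, simp only: stieltjes_integral[OF s nn(1) nn(2)])
    also have "\<dots> = (\<Sum>i\<in>UNIV. ennreal (b i powr s * g i powr (1 - s) * w i)) * stieltjes_const s"
      unfolding sum_distrib_right using nn
      by (intro sum.cong refl) (simp add: ennreal_mult mult_ac)
    also have "\<dots> = ennreal (\<Sum>i\<in>UNIV. b i powr s * g i powr (1 - s) * w i) * stieltjes_const s"
      using nn by (subst sum_ennreal) auto
    finally show ?thesis .
  qed
  have "ennreal (\<Sum>i\<in>UNIV. a i powr s * c i powr (1 - s) * (cmod (T x i))\<^sup>2) * stieltjes_const s
    \<le> ennreal (\<Sum>k\<in>UNIV. \<alpha> k powr s * \<gamma> k powr (1 - s) * (cmod (x k))\<^sup>2) * stieltjes_const s"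
  proof (subst (1 2) integral[symmetric])
    show "(\<integral>\<^sup>+l. indicator {0<..} l * ennreal (l powr (- s - 1) *
          (\<Sum>i\<in>UNIV. c i * (l * a i) / (c i + l * a i) * (cmod (T x i))\<^sup>2)) \<partial>lborel)
        \<le> (\<integral>\<^sup>+l. indicator {0<..} l * ennreal (l powr (- s - 1) *
          (\<Sum>k\<in>UNIV. \<gamma> k * (l * \<alpha> k) / (\<gamma> k + l * \<alpha> k) * (cmod (x k))\<^sup>2)) \<partial>lborel)"
    proof (intro nn_integral_mono)
      fix l :: real
      show "indicator {0<..} l * ennreal (l powr (- s - 1) *
          (\<Sum>i\<in>UNIV. c i * (l * a i) / (c i + l * a i) * (cmod (T x i))\<^sup>2))
        \<le> indicator {0<..} l * ennreal (l powr (- s - 1) *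
          (\<Sum>k\<in>UNIV. \<gamma> k * (l * \<alpha> k) / (\<gamma> k + l * \<alpha> k) * (cmod (x k))\<^sup>2))"
        by (cases "l > 0") (use pointwise[of l] in \<open>simp_all only: indicator_simps greaterThan_iff mult_1
              mult_zero_left ennreal_leI mult_left_mono powr_ge_zero order_refl not_False_eq_True\<close>)
    qed
  qed (use nonneg in auto)
  then have "ennreal (\<Sum>i\<in>UNIV. a i powr s * c i powr (1 - s) * (cmod (T x i))\<^sup>2)
    \<le> ennreal (\<Sum>k\<in>UNIV. \<alpha> k powr s * \<gamma> k powr (1 - s) * (cmod (x k))\<^sup>2)"
    using stieltjes_const_finite[OF s] stieltjes_const_nonzero[OF s(1)]
    by (simp add: mult.commute[of _ "stieltjes_const s"] ennreal_mult_le_mult_iff)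
  then show ?thesis
    by (subst (asm) ennreal_le_iff) (auto intro!: sum_nonneg)
qed

section \<open>Adjoints and positive semidefinite matrices\<close>

lemma conj_transpose_nth [simp]: "conj_transpose A $ i $ j = cnj (A $ j $ i)"
  by (simp add: conj_transpose_def transpose_def)

lemma conj_transpose_simps [simp]:
  "conj_transpose (conj_transpose A) = A"
  "conj_transpose (A + B) = conj_transpose A + conj_transpose B"
  "conj_transpose (A - B) = conj_transpose A - conj_transpose B"
  "conj_transpose (matrix_scale c A) = matrix_scale (cnj c) (conj_transpose A)"
  "conj_transpose (mat 1) = mat 1"
  "conj_transpose (real_diag d) = real_diag d"
  by (auto simp: vec_eq_iff matrix_scale_def mat_def real_diag_def)

lemma conj_transpose_mult: "conj_transpose (A ** B) = conj_transpose B ** conj_transpose A"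
  by (simp add: vec_eq_iff matrix_matrix_mult_def mult.commute)

lemma matrix_scale_mult [simp]:
  "matrix_scale c A ** B = matrix_scale c (A ** B)"
  "A ** matrix_scale c B = matrix_scale c (A ** B)"
  by (simp_all add: vec_eq_iff matrix_matrix_mult_def matrix_scale_def sum_distrib_left mult_ac)

lemma cinner_linear:
  "cinner (u + v) w = cinner u w + cinner v w"
  "cinner u (v + w) = cinner u v + cinner u w"
  "cinner (u - v) w = cinner u w - cinner v w"
  "cinner u (v - w) = cinner u v - cinner u w"
  "cinner (c *s u) v = cnj c * cinner u v"
  "cinner u (c *s v) = c * cinner u v"
  by (simp_all add: cinner_def algebra_simps sum.distrib sum_subtractf sum_distrib_left)

lemma cinner_commute: "cinner v w = cnj (cinner w v)"
  by (simp add: cinner_def mult.commute)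

lemma cinner_adjoint: "cinner v (M *v w) = cinner (conj_transpose M *v v) w"
proof -
  have "cinner v (M *v w) = (\<Sum>i\<in>UNIV. \<Sum>j\<in>UNIV. cnj (v $ i) * (M $ i $ j * w $ j))"
    by (simp add: cinner_def matrix_vector_mult_def sum_distrib_left)
  also have "\<dots> = (\<Sum>j\<in>UNIV. \<Sum>i\<in>UNIV. cnj (v $ i) * (M $ i $ j * w $ j))"
    by (rule sum.swap)
  also have "\<dots> = cinner (conj_transpose M *v v) w"
    by (simp add: cinner_def matrix_vector_mult_def sum_distrib_left sum_distrib_right mult_ac)
  finally show ?thesis .
qed

lemma inner_eq_Re_cinner: "v \<bullet> w = Re (cinner v w)"
  by (simp add: inner_vec_def cinner_def inner_complex_def)

lemma cinner_self: "cinner v v = complex_of_real ((norm v)\<^sup>2)"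
proof (rule complex_eqI)
  show "Re (cinner v v) = Re (complex_of_real ((norm v)\<^sup>2))"
    using inner_eq_Re_cinner[of v v] by (simp add: power2_norm_eq_inner)
  show "Im (cinner v v) = Im (complex_of_real ((norm v)\<^sup>2))"
    by (simp add: cinner_def)
qed

lemma scaleR_conv_scalar_mult: "r *\<^sub>R v = complex_of_real r *s v"
  by (simp add: vec_eq_iff scaleR_conv_of_real[where 'a = complex])

lemma psd_iff: "psd A \<longleftrightarrow> (\<forall>v. Re (cinner v (A *v v)) \<ge> 0 \<and> Im (cinner v (A *v v)) = 0)"
  by (auto simp: psd_def complex_nonneg_Reals_iff)

text \<open>
  Polarization: over the complex field the sesquilinear form is determined by its diagonal.
\<close>

lemma matrix_eq_0_if_quadratic_form_0:
  fixes N :: "complex ^ 'n ^ 'n"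
  assumes "\<And>v. cinner v (N *v v) = 0"
  shows "N = 0"
proof -
  have form: "cinner v (N *v w) = 0" for v w
  proof -
    have a: "cinner v (N *v w) + cinner w (N *v v) = 0"
      using assms[of "v + w"] assms[of v] assms[of w]
      by (simp add: cinner_linear matrix_vector_right_distrib algebra_simps)
    have b: "- \<i> * cinner v (N *v w) + \<i> * cinner w (N *v v) = 0"
      using assms[of "\<i> *s v + w"] assms[of "v"] assms[of w]
      by (simp add: cinner_linear matrix_vector_right_distrib vector_scalar_commute algebra_simps)
    have "\<i> * (cinner w (N *v v) - cinner v (N *v w)) = 0"
      using b by (simp add: algebra_simps)
    then have "cinner w (N *v v) = cinner v (N *v w)" by simp
    with a show ?thesis by simp
  qed
  have "N *v w = 0" for w
    using form[of "N *v w" w] by (simp add: cinner_self)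
  then show ?thesis
    by (simp add: matrix_eq)
qed

lemma psd_imp_hermitian:
  assumes "psd A"
  shows "conj_transpose A = A"
proof -
  have "cinner v ((A - conj_transpose A) *v v) = 0" for v
  proof -
    have "cinner v (conj_transpose A *v v) = cnj (cinner v (A *v v))"
      by (metis cinner_adjoint cinner_commute conj_transpose_simps(1))
    moreover have "Im (cinner v (A *v v)) = 0" using assms by (simp add: psd_iff)
    ultimately show ?thesis
      by (simp add: cinner_linear matrix_vector_mult_diff_rdistrib complex_eq_iff)
  qed
  then have "A - conj_transpose A = 0" by (rule matrix_eq_0_if_quadratic_form_0)
  then show ?thesis by simp
qed

lemma psd_conj:
  fixes A :: "complex ^ 'n ^ 'n" and B :: "complex ^ 'm ^ 'n"
  assumes "psd A"
  shows "psd (conj_transpose B ** A ** B)"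
proof -
  have "cinner v ((conj_transpose B ** A ** B) *v v) = cinner (B *v v) (A *v (B *v v))" for v
    by (simp add: cinner_adjoint matrix_vector_mul_assoc[symmetric])
  then show ?thesis using assms by (simp add: psd_def)
qed

lemma real_diag_mult: "real_diag d ** real_diag e = real_diag (\<lambda>i. d i * e i)"
  by (simp add: vec_eq_iff real_diag_mult_left) (simp add: real_diag_def)

lemma real_diag_mult_vec: "(real_diag d *v v) $ i = complex_of_real (d i) * v $ i"
proof -
  have "(real_diag d *v v) $ i = (\<Sum>j\<in>UNIV. if j = i then complex_of_real (d i) * v $ j else 0)"
    unfolding matrix_vector_mult_def real_diag_def vec_lambda_beta by (intro sum.cong) auto
  then show ?thesis by simp
qed

lemma psd_real_diag_iff: "psd (real_diag d) \<longleftrightarrow> (\<forall>i. d i \<ge> 0)"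
proof
  have form: "cinner v (real_diag d *v v) = complex_of_real (\<Sum>i\<in>UNIV. d i * (cmod (v $ i))\<^sup>2)" for v
    unfolding cinner_def real_diag_mult_vec of_real_sum
    unfolding of_real_mult complex_norm_square by (intro sum.cong refl) (simp add: mult_ac)
  show "psd (real_diag d)" if "\<forall>i. d i \<ge> 0"
    using that by (auto simp: psd_iff form intro!: sum_nonneg)
  show "\<forall>i. d i \<ge> 0" if "psd (real_diag d)"
  proof
    fix i
    have "(\<Sum>j\<in>UNIV. d j * (cmod (axis i (1::complex) $ j))\<^sup>2) = (\<Sum>j\<in>UNIV. if j = i then d j else 0)"
      by (intro sum.cong) (auto simp: axis_def)
    also have "\<dots> = d i" by simp
    moreover have "0 \<le> (\<Sum>j\<in>UNIV. d j * (cmod (axis i (1::complex) $ j))\<^sup>2)"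
      using that[unfolded psd_iff, rule_format, of "axis i 1"] by (simp only: form Re_complex_of_real)
    ultimately show "d i \<ge> 0" by simp
  qed
qed

section \<open>The spectral theorem\<close>

text \<open>
  Complex orthogonality to \<open>k\<close> vectors is real orthogonality to the \<open>2 k\<close> vectors \<open>u\<^sub>i\<close> and \<open>\<i> u\<^sub>i\<close>, and the
  real dimension of the space is \<open>2 n\<close>.
\<close>

lemma exists_orthogonal_vector:
  fixes u :: "'n::finite \<Rightarrow> complex ^ 'n"
  assumes "card I < CARD('n)"
  shows "\<exists>v. norm v = 1 \<and> (\<forall>i\<in>I. cinner (u i) v = 0)"
proof -
  define S where "S = u ` I \<union> (\<lambda>i. \<i> *s u i) ` I"
  have fin: "finite I" by simp
  have "dim S \<le> card S" by (rule dim_le_card') (simp add: S_def)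
  also have "card S \<le> card I + card I"
    unfolding S_def by (meson card_Un_le card_image_le fin add_mono order_trans)
  also have "\<dots> < DIM(complex ^ 'n)" using assms by simp
  finally obtain x where x: "x \<noteq> 0" "\<And>y. y \<in> span S \<Longrightarrow> orthogonal x y"
    using orthogonal_to_subspace_exists[of S] by blast
  have "cinner (u i) x = 0" if "i \<in> I" for i
  proof -
    have "u i \<bullet> x = 0" "(\<i> *s u i) \<bullet> x = 0"
      using x(2)[OF span_base, of "u i"] x(2)[OF span_base, of "\<i> *s u i"] that
      by (auto simp: S_def orthogonal_def inner_commute)
    then show ?thesis
      by (simp add: inner_eq_Re_cinner cinner_linear complex_eq_iff)
  qed
  then have "cinner (u i) (x /\<^sub>R norm x) = 0" if "i \<in> I" for i
    unfolding scaleR_conv_scalar_mult cinner_linear using that by simp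
  moreover have "norm (x /\<^sub>R norm x) = 1" using x(1) by simp
  ultimately show ?thesis by blast
qed

text \<open>
  The orthogonal complement \<open>W\<close> of the given eigenvectors is invariant under \<open>A\<close>, and a maximizer of the
  Rayleigh quotient over the unit sphere of \<open>W\<close> is an eigenvector.
\<close>

lemma exists_orthogonal_eigenvector:
  fixes A :: "complex ^ 'n ^ 'n" and u :: "'n \<Rightarrow> complex ^ 'n"
  assumes herm: "conj_transpose A = A" and card: "card I < CARD('n)"
    and eig: "\<And>i. i \<in> I \<Longrightarrow> A *v u i = complex_of_real (d i) *s u i"
  shows "\<exists>v \<mu>. norm v = 1 \<and> (\<forall>i\<in>I. cinner (u i) v = 0) \<and> A *v v = complex_of_real \<mu> *s v"
proof -
  define W where "W = {v. \<forall>i\<in>I. cinner (u i) v = 0}"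
  define f where "f v = Re (cinner v (A *v v))" for v
  have W_closed: "closed W"
  proof -
    have "continuous_on UNIV (\<lambda>v. cinner (u i) v)" for i
      unfolding cinner_def by (intro continuous_intros)
    then have "closed {v. cinner (u i) v = 0}" for i
      by (intro closed_Collect_eq) auto
    then have "closed (\<Inter>i\<in>I. {v. cinner (u i) v = 0})" by blast
    moreover have "W = (\<Inter>i\<in>I. {v. cinner (u i) v = 0})" by (auto simp: W_def)
    ultimately show ?thesis by simp
  qed
  have W_sub: "v + c *s w \<in> W" if "v \<in> W" "w \<in> W" for v w c
    using that by (simp add: W_def cinner_linear)
  have A_W: "A *v v \<in> W" if "v \<in> W" for v
    using that eig by (simp add: W_def cinner_adjoint herm cinner_linear)
  have "compact (sphere 0 1 \<inter> W)" by (intro compact_Int_closed W_closed compact_sphere)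
  moreover have "sphere 0 1 \<inter> W \<noteq> {}"
    using exists_orthogonal_vector[OF card, of u] by (auto simp: W_def)
  moreover have "continuous_on (sphere 0 1 \<inter> W) f"
    unfolding f_def cinner_def matrix_vector_mult_def vec_lambda_beta
    by (intro continuous_intros)
  ultimately obtain v where v: "v \<in> sphere 0 1 \<inter> W"
      and max: "\<And>w. w \<in> sphere 0 1 \<inter> W \<Longrightarrow> f w \<le> f v"
    using continuous_attains_sup by metis
  define \<mu> where "\<mu> = f v"
  have nv: "norm v = 1" and vW: "v \<in> W" using v by auto
  have bound: "f w \<le> \<mu> * (norm w)\<^sup>2" if "w \<in> W" for w
  proof (cases "w = 0")
    case True then show ?thesis by (simp add: f_def cinner_def)
  next
    case False
    define c where "c = complex_of_real (inverse (norm w))"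
    have "c *s w \<in> W" using that by (simp add: W_def cinner_linear)
    moreover have "c *s w = inverse (norm w) *\<^sub>R w"
      unfolding c_def by (rule scaleR_conv_scalar_mult[symmetric])
    then have "norm (c *s w) = 1" using False by simp
    ultimately have "f (c *s w) \<le> \<mu>" using max by (simp add: \<mu>_def)
    moreover have "f (c *s w) = f w / (norm w)\<^sup>2"
      by (simp add: f_def c_def vector_scalar_commute cinner_linear power2_eq_square divide_simps)
    ultimately show ?thesis using False by (simp add: divide_simps)
  qed
  \<comment> \<open>The form \<open>\<mu>\<parallel>x\<parallel>\<^sup>2 - \<langle>x, A x\<rangle>\<close> is nonnegative on \<open>W\<close> and vanishes at \<open>v\<close>; perturbing \<open>v\<close>
    towards its residual shows that the residual is zero.\<close>
  define w where "w = complex_of_real \<mu> *s v - A *v v"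
  have wW: "w \<in> W" using vW A_W[OF vW] by (simp add: W_def w_def cinner_linear)
  define K where "K = \<mu> * (norm w)\<^sup>2 - f w"
  have quad: "0 \<le> 2 * t * (norm w)\<^sup>2 + t\<^sup>2 * K" for t
  proof -
    define z where "z = v + complex_of_real t *s w"
    have "z \<in> W" using W_sub vW wW by (simp add: z_def)
    then have "f z \<le> \<mu> * (norm z)\<^sup>2" by (rule bound)
    moreover have "(norm z)\<^sup>2 = 1 + 2 * t * Re (cinner w v) + t\<^sup>2 * (norm w)\<^sup>2"
    proof -
      have "(norm z)\<^sup>2 = Re (cinner z z)" by (simp add: cinner_self)
      also have "\<dots> = 1 + t * (Re (cinner w v) + Re (cinner v w)) + t\<^sup>2 * (norm w)\<^sup>2"
        unfolding z_def cinner_linear using nv by (simp add: cinner_self algebra_simps power2_eq_square)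
      finally show ?thesis using cinner_commute[of v w] by simp
    qed
    moreover have "f z = \<mu> + 2 * t * Re (cinner w (A *v v)) + t\<^sup>2 * f w"
    proof -
      have "Re (cinner v (A *v w)) = Re (cinner w (A *v v))"
        using cinner_adjoint[of v A w] cinner_commute[of "A *v v" w] herm by simp
      then show ?thesis
        unfolding f_def \<mu>_def z_def
        by (simp add: cinner_linear matrix_vector_right_distrib vector_scalar_commute
            algebra_simps power2_eq_square)
    qed
    moreover have "(norm w)\<^sup>2 = \<mu> * Re (cinner w v) - Re (cinner w (A *v v))"
    proof -
      have "(norm w)\<^sup>2 = Re (cinner w w)" by (simp add: cinner_self)
      also have "\<dots> = Re (cinner w (complex_of_real \<mu> *s v - A *v v))" by (simp add: w_def)
      finally show ?thesis by (simp add: cinner_linear)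
    qed
    moreover have "0 \<le> 2 * t * n + t\<^sup>2 * (\<mu> * n - F)"
      if "\<mu> + 2 * t * P + t\<^sup>2 * F \<le> \<mu> * (1 + 2 * t * Q + t\<^sup>2 * n)" "n = \<mu> * Q - P" for n P Q F
    proof -
      have "t * n = t * (\<mu> * Q) - t * P" unfolding that(2) by (simp add: algebra_simps)
      with that(1) show ?thesis by (simp add: algebra_simps)
    qed
    ultimately show ?thesis unfolding K_def by metis
  qed
  have "norm w = 0"
  proof (rule ccontr)
    assume "norm w \<noteq> 0"
    then have pos: "(norm w)\<^sup>2 > 0" by simp
    \<comment> \<open>For a small negative \<open>t\<close> the linear term of \<open>quad\<close> dominates.\<close>
    define t where "t = - (norm w)\<^sup>2 / (\<bar>K\<bar> + 1)"
    have "t < 0" using pos by (simp add: t_def divide_neg_pos)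
    moreover have "t * K \<ge> - (norm w)\<^sup>2"
    proof -
      have "\<bar>t * K\<bar> \<le> (norm w)\<^sup>2"
        using pos by (simp add: t_def abs_mult divide_simps)
      then show ?thesis by linarith
    qed
    ultimately have "t * (2 * (norm w)\<^sup>2 + t * K) < 0" using pos by (intro mult_neg_pos) linarith+
    with quad[of t] show False by (simp add: algebra_simps power2_eq_square)
  qed
  then have "A *v v = complex_of_real \<mu> *s v" by (simp add: w_def)
  with nv vW show ?thesis unfolding W_def by blast
qed

text \<open>
  The orthonormal eigenbasis is built one index at a time, the indices being the elements of the type
  \<^typ>\<open>'n\<close> so that the result is directly the family of columns of a matrix.
\<close>

theorem spectral_theorem:
  fixes A :: "complex ^ 'n ^ 'n"
  assumes herm: "conj_transpose A = A"
  shows "\<exists>U d. unitary U \<and> A = U ** real_diag d ** conj_transpose U"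
proof -
  have "\<exists>(u :: 'n \<Rightarrow> complex ^ 'n) d. \<forall>i\<in>I. A *v u i = complex_of_real (d i) *s u i \<and>
      (\<forall>j\<in>I. cinner (u i) (u j) = (if i = j then 1 else 0))" for I :: "'n set"
    using finite[of I]
  proof (induction I rule: finite_induct)
    case (insert k I)
    then obtain u :: "'n \<Rightarrow> complex ^ 'n" and d where
      eig: "\<And>i. i \<in> I \<Longrightarrow> A *v u i = complex_of_real (d i) *s u i"
      and orth: "\<And>i j. i \<in> I \<Longrightarrow> j \<in> I \<Longrightarrow> cinner (u i) (u j) = (if i = j then 1 else 0)"
      by blast
    have "card I < CARD('n)" using insert by (metis UNIV_I finite psubsetI psubset_card_mono subset_UNIV)
    from exists_orthogonal_eigenvector[OF herm this, of u d, OF eig]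
    obtain v \<mu> where v: "norm v = 1" "\<And>i. i \<in> I \<Longrightarrow> cinner (u i) v = 0"
        "A *v v = complex_of_real \<mu> *s v" by auto
    have v': "cinner v (u i) = 0" if "i \<in> I" for i
      using v(2)[OF that] cinner_commute[of v "u i"] by simp
    have "cinner v v = 1" using v(1) by (simp add: cinner_self)
    have 1: "A *v (u(k := v)) i = complex_of_real ((d(k := \<mu>)) i) *s (u(k := v)) i" if "i \<in> insert k I" for i
      using that v(3) eig by auto
    have 2: "cinner ((u(k := v)) i) ((u(k := v)) j) = (if i = j then 1 else 0)"
      if "i \<in> insert k I" "j \<in> insert k I" for i j
      using that v(2) v' \<open>cinner v v = 1\<close> orth insert.hyps(2) by (cases "i = k"; cases "j = k") auto
    show ?case
      by (intro exI[of _ "u(k := v)"] exI[of _ "d(k := \<mu>)"] ballI conjI 1 2)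
  qed simp
  from this[of UNIV] obtain u :: "'n \<Rightarrow> complex ^ 'n" and d where
      eig: "\<And>i. A *v u i = complex_of_real (d i) *s u i"
      and orth: "\<And>i j. cinner (u i) (u j) = (if i = j then 1 else 0)"
    by auto
  define U :: "complex ^ 'n ^ 'n" where "U = (\<chi> i j. u j $ i)"
  have "conj_transpose U ** U = mat 1"
    using orth by (simp add: vec_eq_iff matrix_matrix_mult_def U_def mat_def cinner_def)
  then have un: "unitary U" by (simp add: unitary_def matrix_left_right_inverse)
  have "A ** U = U ** real_diag d"
  proof -
    have "(A ** U) $ i $ j = (A *v u j) $ i" for i j
      by (simp add: matrix_matrix_mult_def matrix_vector_mult_def U_def)
    then show ?thesis
      by (simp add: vec_eq_iff real_diag_mult_right eig) (simp add: U_def mult.commute)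
  qed
  then have "A = U ** real_diag d ** conj_transpose U"
    using un by (metis matrix_mul_assoc matrix_mul_rid unitary_def)
  with un show ?thesis by blast
qed

section \<open>Traces and powers in spectral coordinates\<close>

lemma matrix_diff_ldistrib:
  fixes A B C :: "complex ^ 'n ^ 'n"
  shows "A ** (B - C) = A ** B - A ** C"
  by (simp add: vec_eq_iff matrix_matrix_mult_def algebra_simps sum_subtractf)

lemma matrix_add_rdistrib:
  fixes A B C :: "complex ^ 'n ^ 'n"
  shows "(A + B) ** C = A ** C + B ** C"
  by (simp add: vec_eq_iff matrix_matrix_mult_def algebra_simps sum.distrib)

lemma psd_spectral:
  fixes A :: "complex ^ 'n ^ 'n"
  assumes "psd A"
  obtains U d where "unitary U" "\<And>i. d i \<ge> 0" "A = U ** real_diag d ** conj_transpose U"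
proof -
  obtain U d where U: "unitary U" and A: "A = U ** real_diag d ** conj_transpose U"
    using spectral_theorem[OF psd_imp_hermitian[OF assms]] by blast
  have "conj_transpose U ** A ** U = (conj_transpose U ** U) ** real_diag d ** (conj_transpose U ** U)"
    by (simp add: A matrix_mul_assoc)
  then have "real_diag d = conj_transpose U ** A ** U"
    using U by (simp add: unitary_def)
  then have "\<forall>i. d i \<ge> 0"
    using psd_conj[OF assms, of U] by (metis psd_real_diag_iff)
  with U A that show ?thesis by blast
qed

lemma psd_spectral_form:
  assumes "\<And>i. d i \<ge> 0"
  shows "psd (U ** real_diag d ** conj_transpose U)"
  using psd_conj[of "real_diag d" "conj_transpose U"] assms by (simp add: psd_real_diag_iff)

lemma trace_spectral_form:
  assumes "unitary U"
  shows "trace (U ** real_diag d ** conj_transpose U) = complex_of_real (\<Sum>i\<in>UNIV. d i)"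
proof -
  have "trace (U ** real_diag d ** conj_transpose U) = trace (conj_transpose U ** (U ** real_diag d))"
    by (rule trace_mul_sym)
  also have "\<dots> = trace (real_diag d)"
    using assms by (simp add: matrix_mul_assoc unitary_def)
  finally show ?thesis by (simp add: trace_def real_diag_def)
qed

lemma real_diag_1: "real_diag (\<lambda>_. 1) = mat 1"
  by (simp add: vec_eq_iff real_diag_def mat_def)

lemma mat_1_spectral_form:
  assumes "unitary U"
  shows "U ** real_diag (\<lambda>_. 1) ** conj_transpose U = mat 1"
  using assms by (simp add: real_diag_1 unitary_def)

lemma unitary_mat_1: "unitary (mat 1)"
  by (simp add: unitary_def)

text \<open>
  The bridge between traces and weighted \<open>\<ell>\<^sup>2\<close> norms: one matrix acts on \<open>Y\<close> from the left and the other
  from the right, so both are diagonal for the matrix units built from the eigenbases \<open>U\<close> and \<open>V\<close>.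
\<close>

lemma trace_weighted_form:
  fixes U V Y :: "complex ^ 'n ^ 'n"
  shows "trace ((V ** real_diag c ** conj_transpose V) **
      (conj_transpose Y ** (U ** real_diag a ** conj_transpose U) ** Y))
    = complex_of_real (\<Sum>i\<in>UNIV. \<Sum>j\<in>UNIV. a i * c j * (cmod ((conj_transpose U ** Y ** V) $ i $ j))\<^sup>2)"
proof -
  define W where "W = conj_transpose U ** Y ** V"
  have "trace ((V ** real_diag c ** conj_transpose V) **
      (conj_transpose Y ** (U ** real_diag a ** conj_transpose U) ** Y))
    = trace (V ** (real_diag c ** conj_transpose V **
      conj_transpose Y ** U ** real_diag a ** conj_transpose U ** Y))"
    by (simp add: matrix_mul_assoc)
  also have "\<dots> = trace ((real_diag c ** conj_transpose V **
      conj_transpose Y ** U ** real_diag a ** conj_transpose U ** Y) ** V)"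
    by (rule trace_mul_sym)
  also have "\<dots> = trace (real_diag c ** (conj_transpose W ** (real_diag a ** W)))"
    by (simp add: W_def conj_transpose_mult matrix_mul_assoc)
  also have "\<dots> = (\<Sum>j\<in>UNIV. complex_of_real (c j) *
      (\<Sum>i\<in>UNIV. cnj (W $ i $ j) * (complex_of_real (a i) * W $ i $ j)))"
    unfolding trace_def real_diag_mult_left
    by (simp add: matrix_matrix_mult_def[of "conj_transpose W"] real_diag_mult_left)
  also have "\<dots> = (\<Sum>j\<in>UNIV. \<Sum>i\<in>UNIV. complex_of_real (a i * c j * (cmod (W $ i $ j))\<^sup>2))"
    unfolding of_real_mult complex_norm_square sum_distrib_left
    by (intro sum.cong refl) (simp add: mult_ac)
  also have "\<dots> = complex_of_real (\<Sum>i\<in>UNIV. \<Sum>j\<in>UNIV. a i * c j * (cmod (W $ i $ j))\<^sup>2)"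
    unfolding of_real_sum by (rule sum.swap)
  finally show ?thesis unfolding W_def .
qed

lemma psd_square: "psd (conj_transpose X ** X)"
  using psd_conj[of "mat 1" X] psd_real_diag_iff[of "\<lambda>_. 1"] by (simp add: real_diag_1)

lemma psd_add: "psd A \<Longrightarrow> psd B \<Longrightarrow> psd (A + B)"
  by (simp add: psd_iff matrix_vector_mult_add_rdistrib cinner_linear)

lemma psd_eq_square:
  fixes A :: "complex ^ 'n ^ 'n"
  assumes "psd A"
  obtains X :: "complex ^ 'n ^ 'n" where "A = conj_transpose X ** X"
proof -
  obtain U :: "complex ^ 'n ^ 'n" and d where d: "\<And>i. d i \<ge> 0"
    and A: "A = U ** real_diag d ** conj_transpose U" using psd_spectral[OF assms] by blast
  define X where "X = real_diag (\<lambda>i. sqrt (d i)) ** conj_transpose U"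
  have "real_diag (\<lambda>i. sqrt (d i)) ** real_diag (\<lambda>i. sqrt (d i)) = real_diag d"
    using d by (simp add: real_diag_mult)
  then have "A = conj_transpose X ** X"
    by (simp add: A X_def conj_transpose_mult) (metis matrix_mul_assoc)
  with that show ?thesis by blast
qed

lemma trace_mult_psd_nonneg:
  fixes A B :: "complex ^ 'n ^ 'n"
  assumes "psd A" "psd B"
  shows "Re (trace (A ** B)) \<ge> 0"
proof -
  obtain U :: "complex ^ 'n ^ 'n" and d where d: "\<And>i. d i \<ge> 0"
    and A: "A = U ** real_diag d ** conj_transpose U" using psd_spectral[OF assms(1)] by blast
  from assms(2) obtain X :: "complex ^ 'n ^ 'n" where "B = conj_transpose X ** X" by (rule psd_eq_square)
  then have "B = conj_transpose X ** (mat 1 ** real_diag (\<lambda>_. 1) ** conj_transpose (mat 1)) ** X"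
    by (simp add: real_diag_1)
  then show ?thesis
    unfolding A using d by (simp only: trace_weighted_form) (auto intro!: sum_nonneg)
qed

lemma trace_mult_mono:
  assumes "psd A" "M \<le>\<^sub>L N"
  shows "Re (trace (A ** M)) \<le> Re (trace (A ** N))"
  using trace_mult_psd_nonneg[of A "N - M"] assms
  by (simp add: loewner_le_def matrix_diff_ldistrib trace_sub)

definition outer :: "complex ^ 'n \<Rightarrow> complex ^ 'n ^ 'n"
  where "outer v = (\<chi> i j. v $ i * cnj (v $ j))"

lemma trace_outer: "trace (outer v ** M) = cinner v (M *v v)"
proof -
  have "trace (outer v ** M) = (\<Sum>i\<in>UNIV. \<Sum>k\<in>UNIV. v $ i * cnj (v $ k) * M $ k $ i)"
    by (simp add: trace_def matrix_matrix_mult_def outer_def)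
  also have "\<dots> = (\<Sum>k\<in>UNIV. \<Sum>i\<in>UNIV. v $ i * cnj (v $ k) * M $ k $ i)"
    by (rule sum.swap)
  finally show ?thesis
    by (simp add: cinner_def matrix_vector_mult_def sum_distrib_left mult_ac)
qed

lemma psd_outer: "psd (outer v)"
proof -
  have "cinner w (outer v *v w) = cnj (cinner v w) * cinner v w" for w
  proof -
    have "outer v *v w = cinner v w *s v"
      by (simp add: vec_eq_iff outer_def matrix_vector_mult_def cinner_def sum_distrib_left
          sum_distrib_right mult_ac)
    then show ?thesis by (simp add: cinner_linear cinner_commute[of w v])
  qed
  then show ?thesis
    by (simp add: psd_iff)
qed

lemma psd_powr_spectral_form:
  assumes "unitary U" "\<And>i. d i \<ge> 0"
  shows "psd_powr (U ** real_diag d ** conj_transpose U) p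
    = U ** real_diag (\<lambda>i. d i powr p) ** conj_transpose U"
  using assms by (intro psd_powr_eqI) auto

lemma psd_psd_powr:
  assumes "psd A"
  shows "psd (psd_powr A p)"
proof -
  obtain U d where "unitary U" "\<And>i. d i \<ge> 0" "A = U ** real_diag d ** conj_transpose U"
    using psd_spectral[OF assms] by blast
  then show ?thesis by (simp add: psd_powr_spectral_form psd_spectral_form)
qed

lemma psd_powr_1:
  assumes "psd A"
  shows "psd_powr A 1 = A"
proof -
  obtain U d where "unitary U" "\<And>i. d i \<ge> 0" "A = U ** real_diag d ** conj_transpose U"
    using psd_spectral[OF assms] by blast
  then show ?thesis by (simp add: psd_powr_spectral_form)
qed

lemma psd_powr_scalar:
  assumes "k \<ge> 0"
  shows "psd_powr (matrix_scale (complex_of_real k) (mat 1 :: complex ^ 'n ^ 'n)) p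
    = matrix_scale (complex_of_real (k powr p)) (mat 1)"
proof -
  have "matrix_scale (complex_of_real x) (mat 1 :: complex ^ 'n ^ 'n) = mat 1 ** real_diag (\<lambda>_. x) ** conj_transpose (mat 1)" for x
    unfolding conj_transpose_simps matrix_mul_lid matrix_mul_rid
    by (simp add: vec_eq_iff matrix_scale_def real_diag_def mat_def)
  then show ?thesis
    using assms psd_powr_spectral_form[OF unitary_mat_1, of "\<lambda>_. k" p] by simp
qed

text \<open>
  If one of the two matrices is the identity, any orthonormal basis can serve as its eigenbasis. This freedom allows
  the same coordinates of \<open>Y\<close> to be used at both ends of an interpolation.
\<close>

lemma trace_weighted_form_left:
  fixes U V Y :: "complex ^ 'n ^ 'n"
  assumes "unitary V"
  shows "Re (trace (conj_transpose Y ** (U ** real_diag a ** conj_transpose U) ** Y))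
    = (\<Sum>i\<in>UNIV. \<Sum>j\<in>UNIV. a i * (cmod ((conj_transpose U ** Y ** V) $ i $ j))\<^sup>2)"
  using trace_weighted_form[of V "\<lambda>_. 1" Y U a] by (simp add: mat_1_spectral_form[OF assms])

lemma trace_weighted_form_right:
  fixes U V Y :: "complex ^ 'n ^ 'n"
  assumes "unitary U"
  shows "Re (trace ((V ** real_diag c ** conj_transpose V) ** (conj_transpose Y ** Y)))
    = (\<Sum>i\<in>UNIV. \<Sum>j\<in>UNIV. c j * (cmod ((conj_transpose U ** Y ** V) $ i $ j))\<^sup>2)"
  using trace_weighted_form[of V c Y U "\<lambda>_. 1"] by (simp add: mat_1_spectral_form[OF assms])

text \<open>
  With \<open>Y\<close> and \<open>Z\<close> diagonalized, the trace of \<open>Y Z\<close> is a sum of products of eigenvalues against the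
  squared entries of a unitary matrix, and Young's inequality applies to each product. The sums on the right
  are recognized as traces by the same formula. The parameter \<open>w\<close> rescales the pair to
  \<open>(w Y, w\<^sup>-\<^sup>1 Z)\<close>.
\<close>

lemma trace_young:
  fixes Y Z :: "complex ^ 'n ^ 'n"
  assumes "psd Y" "psd Z" and pq: "p > 1" "q > 1" "1 / q + 1 / p = 1" and w: "w > 0"
  shows "Re (trace (Y ** Z))
    \<le> w powr q * (Re (trace (psd_powr Y q)) / q) + w powr (- p) * (Re (trace (psd_powr Z p)) / p)"
proof -
  obtain V y where V: "unitary V" and y: "\<And>i. y i \<ge> 0" and Y: "Y = V ** real_diag y ** conj_transpose V"
    using psd_spectral[OF assms(1)] by blast
  obtain U z where U: "unitary U" and z: "\<And>i. z i \<ge> 0" and Z: "Z = U ** real_diag z ** conj_transpose U"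
    using psd_spectral[OF assms(2)] by blast
  define W where "W = conj_transpose U ** mat 1 ** V"
  have "Re (trace (Y ** Z)) = (\<Sum>i\<in>UNIV. \<Sum>j\<in>UNIV. z i * y j * (cmod (W $ i $ j))\<^sup>2)"
    using trace_weighted_form[of V y "mat 1" U z] by (simp add: Y Z W_def)
  also have "\<dots> \<le> (\<Sum>i\<in>UNIV. \<Sum>j\<in>UNIV. (w powr q / q) * (y j powr q * (cmod (W $ i $ j))\<^sup>2)
      + (w powr (- p) / p) * (z i powr p * (cmod (W $ i $ j))\<^sup>2))"
  proof (intro sum_mono)
    fix i j
    have "(w * y j) * (inverse w * z i) \<le> (w * y j) powr q / q + (inverse w * z i) powr p / p"
      using y z w pq by (intro Youngs_inequality) auto
    moreover have "(w * y j) * (inverse w * z i) = z i * y j" using w by simp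
    moreover have "(w * y j) powr q / q = (w powr q / q) * y j powr q"
      using w y by (simp add: powr_mult)
    moreover have "(inverse w * z i) powr p / p = (w powr (- p) / p) * z i powr p"
      using w z by (simp add: powr_mult powr_minus inverse_powr)
    ultimately have "z i * y j \<le> (w powr q / q) * y j powr q + (w powr (- p) / p) * z i powr p"
      by (simp only:)
    from mult_right_mono[OF this zero_le_power2[of "cmod (W $ i $ j)"]]
    show "z i * y j * (cmod (W $ i $ j))\<^sup>2 \<le> (w powr q / q) * (y j powr q * (cmod (W $ i $ j))\<^sup>2)
      + (w powr (- p) / p) * (z i powr p * (cmod (W $ i $ j))\<^sup>2)"
      by (simp only: distrib_right mult.assoc)
  qed
  also have "\<dots> = (w powr q / q) * (\<Sum>i\<in>UNIV. \<Sum>j\<in>UNIV. y j powr q * (cmod (W $ i $ j))\<^sup>2)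
      + (w powr (- p) / p) * (\<Sum>i\<in>UNIV. \<Sum>j\<in>UNIV. z i powr p * (cmod (W $ i $ j))\<^sup>2)"
    by (simp only: sum.distrib sum_distrib_left)
  also have "(\<Sum>i\<in>UNIV. \<Sum>j\<in>UNIV. y j powr q * (cmod (W $ i $ j))\<^sup>2) = Re (trace (psd_powr Y q))"
    using trace_weighted_form_right[OF U, of V "\<lambda>j. y j powr q" "mat 1"] V y
    by (simp add: W_def Y psd_powr_spectral_form)
  also have "(\<Sum>i\<in>UNIV. \<Sum>j\<in>UNIV. z i powr p * (cmod (W $ i $ j))\<^sup>2) = Re (trace (psd_powr Z p))"
    using trace_weighted_form_left[OF V, of "mat 1" U "\<lambda>i. z i powr p"] U z
    by (simp add: W_def Z psd_powr_spectral_form)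
  finally show ?thesis by simp
qed

lemma conj_diag_entry:
  "(conj_transpose W ** M ** W) $ i $ i = cinner (column i W) (M *v column i W)"
proof -
  have "(conj_transpose W ** M ** W) $ i $ i = (conj_transpose W ** (M ** W)) $ i $ i"
    by (simp add: matrix_mul_assoc)
  then show ?thesis
    by (simp add: matrix_matrix_mult_def cinner_def matrix_vector_mult_def column_def)
qed

section \<open>Schwarz maps\<close>

lemma hs_inner_conj_transpose: "hs_inner (conj_transpose X) Y = trace (X ** Y)"
  by (simp add: hs_inner_def)

locale unital_schwarz =
  fixes \<Phi> :: "complex ^ 'm ^ 'm \<Rightarrow> complex ^ 'n ^ 'n"
  assumes schwarz: "schwarz_map \<Phi>" and unital: "unital_map \<Phi>"
begin

lemma clinear: "clinear_map \<Phi>"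
  using schwarz by (simp add: schwarz_map_def)

lemma map_add: "\<Phi> (X + Y) = \<Phi> X + \<Phi> Y"
  and map_scale: "\<Phi> (matrix_scale c X) = matrix_scale c (\<Phi> X)"
  using clinear by (auto simp: clinear_map_iff)

lemma map_one: "\<Phi> (mat 1) = mat 1"
  using unital by (simp add: unital_map_def)

lemma map_square_ge: "conj_transpose (\<Phi> X) ** \<Phi> X \<le>\<^sub>L \<Phi> (conj_transpose X ** X)"
  using schwarz by (simp add: schwarz_map_def)

lemma map_psd:
  assumes "psd P"
  shows "psd (\<Phi> P)"
proof -
  from assms obtain X :: "complex ^ 'm ^ 'm" where P: "P = conj_transpose X ** X" by (rule psd_eq_square)
  have "psd (\<Phi> P - conj_transpose (\<Phi> X) ** \<Phi> X)"
    using map_square_ge[of X] by (simp add: loewner_le_def P)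
  from psd_add[OF this psd_square[of "\<Phi> X"]] show ?thesis by simp
qed

text \<open>
  For \<open>Y = 1 + z X\<close>, hermiticity of \<open>\<Phi>(Y\<^sup>* Y)\<close> shows that \<open>z \<Phi>(X) + z\<^sup>* \<Phi>(X\<^sup>*)\<close> is Hermitian for every scalar \<open>z\<close>.
  The values \<open>z = 1\<close> and \<open>z = \<i>\<close> separate the two terms.
\<close>

lemma map_conj_transpose: "\<Phi> (conj_transpose X) = conj_transpose (\<Phi> X)"
proof -
  have herm: "conj_transpose (\<Phi> P) = \<Phi> P" if "psd P" for P
    using that by (intro psd_imp_hermitian map_psd)
  have eq: "matrix_scale (cnj z) (conj_transpose (\<Phi> X)) + matrix_scale z (conj_transpose (\<Phi> (conj_transpose X)))
     = matrix_scale z (\<Phi> X) + matrix_scale (cnj z) (\<Phi> (conj_transpose X))" for z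
  proof -
    define Y where "Y = mat 1 + matrix_scale z X"
    have sq: "conj_transpose Y ** Y = mat 1 + matrix_scale z X + matrix_scale (cnj z) (conj_transpose X)
        + matrix_scale (cnj z * z) (conj_transpose X ** X)"
      by (simp add: Y_def matrix_add_ldistrib matrix_add_rdistrib)
        (simp add: vec_eq_iff matrix_scale_def algebra_simps)
    have "conj_transpose (matrix_scale (cnj z * z) (\<Phi> (conj_transpose X ** X)))
        = matrix_scale (cnj z * z) (\<Phi> (conj_transpose X ** X))"
      using herm[OF psd_square[of X]] by (simp add: mult.commute)
    then show ?thesis
      using herm[OF psd_square[of Y]] unfolding sq map_add map_scale map_one
      by (simp add: algebra_simps)
  qed
  have "cnj (\<Phi> X $ j $ i) = \<Phi> (conj_transpose X) $ i $ j" for i j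
  proof -
    have "cnj z * cnj (\<Phi> X $ j $ i) + z * cnj (\<Phi> (conj_transpose X) $ j $ i)
        = z * \<Phi> X $ i $ j + cnj z * \<Phi> (conj_transpose X) $ i $ j" for z
      using arg_cong[OF eq[of z], of "\<lambda>M. M $ i $ j"] by (simp add: matrix_scale_def)
    from this[of 1] this[of \<i>] show ?thesis
      by (simp add: complex_eq_iff)
  qed
  then show ?thesis by (simp add: vec_eq_iff)
qed

lemma trace_adjoint: "trace (\<Phi> X ** A) = trace (X ** hs_adjoint \<Phi> A)"
  using hs_adjoint_works[OF clinear, of "conj_transpose X" A]
  by (simp add: map_conj_transpose hs_inner_conj_transpose)

lemma cinner_adjoint_map: "cinner v (hs_adjoint \<Phi> A *v v) = trace (\<Phi> (outer v) ** A)"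
  by (simp add: trace_adjoint trace_outer)

text \<open>
  The quadratic form of \<open>\<Phi>\<^sup>\<dagger>(A)\<close> at \<open>v\<close> is the trace of the product of the positive matrices \<open>\<Phi>(v v\<^sup>*)\<close> and \<open>A\<close>.
\<close>

lemma adjoint_psd:
  assumes "psd A"
  shows "psd (hs_adjoint \<Phi> A)"
proof -
  have "Im (trace (P ** A)) = 0" if "psd P" for P
  proof -
    have "cnj (trace (P ** A)) = trace (conj_transpose (P ** A))"
      by (simp add: trace_def)
    also have "\<dots> = trace (P ** A)"
      using that assms by (simp add: conj_transpose_mult psd_imp_hermitian trace_mul_sym[of A])
    finally show ?thesis by (simp add: complex_eq_iff)
  qed
  then show ?thesis
    using trace_mult_psd_nonneg[OF map_psd[OF psd_outer] assms] map_psd[OF psd_outer]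
    unfolding psd_iff[of "hs_adjoint \<Phi> A"] cinner_adjoint_map by blast
qed

text \<open>
  The Schwarz inequality tested against \<open>A\<close>. It is the endpoint of the interpolation at which the positive
  matrix stands on the right of \<open>X\<close>.
\<close>

lemma trace_square_le:
  assumes "psd A"
  shows "Re (trace (A ** (conj_transpose (\<Phi> X) ** \<Phi> X)))
    \<le> Re (trace (hs_adjoint \<Phi> A ** (conj_transpose X ** X)))"
proof -
  have "Re (trace (A ** (conj_transpose (\<Phi> X) ** \<Phi> X))) \<le> Re (trace (A ** \<Phi> (conj_transpose X ** X)))"
    using assms map_square_ge by (rule trace_mult_mono)
  then show ?thesis
    by (simp add: trace_mul_sym[of A] trace_adjoint trace_mul_sym[of "hs_adjoint \<Phi> A"])
qed

text \<open>
  The other endpoint estimate, with the positive matrix on the left of \<open>X\<close>: it is the previous one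
  applied to \<open>X\<^sup>*\<close>.
\<close>

lemma trace_square_le':
  assumes "psd A"
  shows "Re (trace (conj_transpose (\<Phi> X) ** A ** \<Phi> X))
    \<le> Re (trace (conj_transpose X ** hs_adjoint \<Phi> A ** X))"
proof -
  have cyc: "trace (conj_transpose Y ** M ** Y) = trace (M ** (conj_transpose (conj_transpose Y) ** conj_transpose Y))"
    for Y M :: "complex ^ 'k ^ 'k"
    by (metis conj_transpose_simps(1) matrix_mul_assoc trace_mul_sym)
  show ?thesis
    unfolding cyc using trace_square_le[OF assms, of "conj_transpose X"] by (simp add: map_conj_transpose)
qed

end

section \<open>Monotonicity of Lieb's functional\<close>

lemma sum_UNIV_prod: "(\<Sum>p\<in>UNIV. f p) = (\<Sum>i\<in>UNIV. \<Sum>j\<in>UNIV. f (i, j))"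
  by (simp add: sum.cartesian_product flip: UNIV_Times_UNIV)

context unital_schwarz
begin

text \<open>
  In the eigenbases of \<open>A\<close>, \<open>C\<close> and of their images the two endpoint estimates are the hypotheses of
  \<open>quadratic_interpolation\<close> for the coordinate form \<open>T\<close> of \<open>\<Phi>\<close>. A matrix \<open>X\<close> is represented by its entries
  \<open>x (i, j)\<close> with respect to the pair of eigenbases \<open>(U', V')\<close>.
\<close>

theorem lieb_monotonicity:
  assumes s: "0 < s" "s < 1" and "psd A" "psd C"
  shows "Re (trace (psd_powr C (1 - s) ** (conj_transpose (\<Phi> B) ** psd_powr A s ** \<Phi> B)))
    \<le> Re (trace (psd_powr (hs_adjoint \<Phi> C) (1 - s) **
        (conj_transpose B ** psd_powr (hs_adjoint \<Phi> A) s ** B)))"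
proof -
  obtain U a where U: "unitary U" and a: "\<And>i. a i \<ge> 0" and A: "A = U ** real_diag a ** conj_transpose U"
    using psd_spectral[OF \<open>psd A\<close>] by blast
  obtain V c where V: "unitary V" and c: "\<And>i. c i \<ge> 0" and C: "C = V ** real_diag c ** conj_transpose V"
    using psd_spectral[OF \<open>psd C\<close>] by blast
  obtain U' \<alpha> where U': "unitary U'" and \<alpha>: "\<And>i. \<alpha> i \<ge> 0"
    and A': "hs_adjoint \<Phi> A = U' ** real_diag \<alpha> ** conj_transpose U'"
    using psd_spectral[OF adjoint_psd[OF \<open>psd A\<close>]] by blast
  obtain V' \<gamma> where V': "unitary V'" and \<gamma>: "\<And>i. \<gamma> i \<ge> 0"
    and C': "hs_adjoint \<Phi> C = V' ** real_diag \<gamma> ** conj_transpose V'"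
    using psd_spectral[OF adjoint_psd[OF \<open>psd C\<close>]] by blast
  define M :: "('m \<times> 'm \<Rightarrow> complex) \<Rightarrow> complex ^ 'm ^ 'm"
    where "M x = U' ** (\<chi> i j. x (i, j)) ** conj_transpose V'" for x
  define T :: "('m \<times> 'm \<Rightarrow> complex) \<Rightarrow> 'n \<times> 'n \<Rightarrow> complex"
    where "T x p = (conj_transpose U ** \<Phi> (M x) ** V) $ fst p $ snd p" for x p
  have coord: "(conj_transpose U' ** M x ** V') $ i $ j = x (i, j)" for x i j
  proof -
    have "conj_transpose U' ** M x ** V'
      = (conj_transpose U' ** U') ** (\<chi> i j. x (i, j)) ** (conj_transpose V' ** V')"
      by (simp add: M_def matrix_mul_assoc)
    then show ?thesis using U' V' by (simp add: unitary_def)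
  qed
  have M_add: "M (\<lambda>k. x k + y k) = M x + M y" for x y
  proof -
    have "(\<chi> i j. x (i, j) + y (i, j)) = (\<chi> i j. x (i, j)) + (\<chi> i j. y (i, j))"
      by (simp add: vec_eq_iff)
    then show ?thesis by (simp add: M_def matrix_add_ldistrib matrix_add_rdistrib)
  qed
  define x where "x p = (conj_transpose U' ** B ** V') $ fst p $ snd p" for p
  have M_x: "M x = B"
  proof -
    have "M x = (U' ** conj_transpose U') ** B ** (V' ** conj_transpose V')"
      by (simp add: M_def x_def matrix_mul_assoc)
    then show ?thesis using U' V' by (simp add: unitary_def)
  qed
  have "(\<Sum>p\<in>UNIV. a (fst p) powr s * c (snd p) powr (1 - s) * (cmod (T x p))\<^sup>2)
    \<le> (\<Sum>p\<in>UNIV. \<alpha> (fst p) powr s * \<gamma> (snd p) powr (1 - s) * (cmod (x p))\<^sup>2)"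
  proof (rule quadratic_interpolation[OF s])
    show "T (\<lambda>k. x k + y k) p = T x p + T y p" for x y p
      by (simp add: T_def M_add map_add matrix_add_ldistrib matrix_add_rdistrib)
    show "(\<Sum>p\<in>UNIV. c (snd p) * (cmod (T x p))\<^sup>2) \<le> (\<Sum>p\<in>UNIV. \<gamma> (snd p) * (cmod (x p))\<^sup>2)" for x
      using trace_square_le[OF \<open>psd C\<close>, of "M x"]
      unfolding C' unfolding C trace_weighted_form_right[OF U] trace_weighted_form_right[OF U'] coord
      by (simp add: sum_UNIV_prod T_def)
    show "(\<Sum>p\<in>UNIV. a (fst p) * (cmod (T x p))\<^sup>2) \<le> (\<Sum>p\<in>UNIV. \<alpha> (fst p) * (cmod (x p))\<^sup>2)" for x
      using trace_square_le'[OF \<open>psd A\<close>, of "M x"]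
      unfolding A' unfolding A trace_weighted_form_left[OF V] trace_weighted_form_left[OF V'] coord
      by (simp add: sum_UNIV_prod T_def)
  qed (use a c \<alpha> \<gamma> in auto)
  then show ?thesis
    unfolding A' C' unfolding A C using U V U' V' a c \<alpha> \<gamma>
    by (simp add: psd_powr_spectral_form trace_weighted_form sum_UNIV_prod T_def M_x x_def)
qed

end

section \<open>The trace Jensen inequality for the adjoint\<close>

context unital_schwarz
begin

text \<open>
  Each eigenvalue \<open>\<gamma>\<^sub>i\<close> of \<open>\<Phi>\<^sup>\<dagger>(C)\<close> is a nonnegative combination of the eigenvalues \<open>c\<^sub>j\<close> of \<open>C\<close> whose
  coefficients sum over \<open>j\<close> to \<open>k\<close>, because \<open>\<Phi>\<^sup>\<dagger>(1) = k 1\<close>, and over \<open>i\<close> to \<open>1\<close>, because \<open>\<Phi>\<close> is unital. Jensen's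
  inequality for each \<open>i\<close> and summation over \<open>i\<close> give the claim.
\<close>

lemma trace_powr_adjoint_le:
  assumes semi: "hs_adjoint \<Phi> (mat 1) = matrix_scale (complex_of_real k) (mat 1)" and k: "k > 0"
    and "psd C" and t: "t \<ge> 1"
  shows "Re (trace (psd_powr (hs_adjoint \<Phi> C) t)) \<le> k powr (t - 1) * Re (trace (psd_powr C t))"
proof -
  obtain V c where V: "unitary V" and c: "\<And>i. c i \<ge> 0" and C: "C = V ** real_diag c ** conj_transpose V"
    using psd_spectral[OF \<open>psd C\<close>] by blast
  obtain W \<gamma> where W: "unitary W" and \<gamma>: "\<And>i. \<gamma> i \<ge> 0"
    and C': "hs_adjoint \<Phi> C = W ** real_diag \<gamma> ** conj_transpose W"
    using psd_spectral[OF adjoint_psd[OF \<open>psd C\<close>]] by blast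
  \<comment> \<open>\<open>L d i\<close> is the \<open>i\<close>-th diagonal entry, in the eigenbasis of \<open>\<Phi>\<^sup>\<dagger>(C)\<close>, of the image of the matrix with
    eigenvalues \<open>d\<close> in the eigenbasis of \<open>C\<close>.\<close>
  define L where "L d i = Re ((conj_transpose W **
      hs_adjoint \<Phi> (V ** real_diag d ** conj_transpose V) ** W) $ i $ i)" for d i
  have "\<exists>P. (\<forall>j. P j \<ge> 0) \<and> (\<forall>d. L d i = (\<Sum>j\<in>UNIV. P j * d j))" for i
  proof -
    obtain Q :: "complex ^ 'n ^ 'n" where Q: "\<Phi> (outer (column i W)) = conj_transpose Q ** Q"
      using psd_eq_square[OF map_psd[OF psd_outer]] by blast
    have "L d i = (\<Sum>j\<in>UNIV. (\<Sum>k\<in>UNIV. (cmod ((conj_transpose (mat 1) ** Q ** V) $ k $ j))\<^sup>2) * d j)" for d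
    proof -
      have "L d i = Re (trace ((V ** real_diag d ** conj_transpose V) ** (conj_transpose Q ** Q)))"
        unfolding L_def conj_diag_entry cinner_adjoint_map Q
        by (rule arg_cong[where f = Re], rule trace_mul_sym)
      also have "\<dots> = (\<Sum>k\<in>UNIV. \<Sum>j\<in>UNIV. d j * (cmod ((conj_transpose (mat 1) ** Q ** V) $ k $ j))\<^sup>2)"
        by (rule trace_weighted_form_right[OF unitary_mat_1])
      also have "\<dots> = (\<Sum>j\<in>UNIV. \<Sum>k\<in>UNIV. d j * (cmod ((conj_transpose (mat 1) ** Q ** V) $ k $ j))\<^sup>2)"
        by (rule sum.swap)
      finally show ?thesis by (simp only: sum_distrib_left[symmetric] mult.commute)
    qed
    then show ?thesis
      by (intro exI[of _ "\<lambda>j. \<Sum>k\<in>UNIV. (cmod ((conj_transpose (mat 1) ** Q ** V) $ k $ j))\<^sup>2"])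
        (auto intro!: sum_nonneg)
  qed
  then obtain P where P: "\<And>i j. P i j \<ge> 0" and L: "\<And>d i. L d i = (\<Sum>j\<in>UNIV. P i j * d j)"
    by metis
  have WW: "conj_transpose W ** W = mat 1" "W ** conj_transpose W = mat 1"
    using W by (auto simp: unitary_def)
  have L_c: "L c i = \<gamma> i" for i
  proof -
    have "conj_transpose W ** (W ** real_diag \<gamma> ** conj_transpose W) ** W
      = (conj_transpose W ** W) ** real_diag \<gamma> ** (conj_transpose W ** W)"
      by (simp add: matrix_mul_assoc)
    then show ?thesis
      unfolding L_def C[symmetric] C' by (simp add: WW) (simp add: real_diag_def)
  qed
  have L_1: "L (\<lambda>_. 1) i = k" for i
    unfolding L_def mat_1_spectral_form[OF V] semi by (simp add: WW) (simp add: matrix_scale_def mat_def)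
  have L_sum: "(\<Sum>i\<in>UNIV. L d i) = (\<Sum>j\<in>UNIV. d j)" for d
  proof -
    define D where "D = V ** real_diag d ** conj_transpose V"
    have "(\<Sum>i\<in>UNIV. L d i) = Re (trace (conj_transpose W ** hs_adjoint \<Phi> D ** W))"
      by (simp add: L_def trace_def D_def)
    also have "trace (conj_transpose W ** hs_adjoint \<Phi> D ** W) = trace (W ** (conj_transpose W ** hs_adjoint \<Phi> D))"
      by (rule trace_mul_sym)
    also have "\<dots> = trace (\<Phi> (mat 1) ** D)"
      by (simp add: matrix_mul_assoc WW trace_adjoint)
    also have "\<dots> = trace D" by (simp add: map_one)
    finally show ?thesis by (simp add: D_def trace_spectral_form[OF V])
  qed
  have "(\<Sum>i\<in>UNIV. \<gamma> i powr t) \<le> (\<Sum>i\<in>UNIV. k powr (t - 1) * L (\<lambda>j. c j powr t) i)"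
  proof (intro sum_mono)
    fix i
    show "\<gamma> i powr t \<le> k powr (t - 1) * L (\<lambda>j. c j powr t) i"
      unfolding L_c[symmetric] L using P c k t L_1[of i]
      by (intro powr_weighted_sum_le) (auto simp: L)
  qed
  also have "\<dots> = k powr (t - 1) * (\<Sum>j\<in>UNIV. c j powr t)"
    by (simp only: sum_distrib_left[symmetric] L_sum)
  finally show ?thesis
    unfolding C' unfolding C using V W c \<gamma> by (simp add: psd_powr_spectral_form trace_spectral_form)
qed

end

section \<open>The trace inequality\<close>

theorem theorem3p3:
  fixes s r :: real
    and \<Phi> :: "complex ^ 'm ^ 'm \<Rightarrow> complex ^ 'n ^ 'n"
    and A :: "complex ^ 'n ^ 'n"
    and B :: "complex ^ 'm ^ 'm"
  assumes "0 < s" "s \<le> 1" "s \<le> r" "r \<le> 1"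
    and "schwarz_map \<Phi>" "sesquiunital_map \<Phi>"
    and "psd A"
  shows "Re (trace (psd_powr (conj_transpose (\<Phi> B) ** psd_powr A s ** \<Phi> B) (r / s)))
    \<le> (real CARD('n) / real CARD('m)) powr (1 - r) *
      Re (trace (psd_powr (conj_transpose B ** psd_powr (hs_adjoint \<Phi> A) s ** B) (r / s)))"
proof -
  interpret unital_schwarz \<Phi>
    using assms by unfold_locales (auto simp: sesquiunital_map_def)
  define k where "k = real CARD('n) / real CARD('m)"
  have k: "k > 0" by (simp add: k_def)
  have semi: "hs_adjoint \<Phi> (mat 1) = matrix_scale (complex_of_real k) (mat 1)"
    using assms by (simp add: sesquiunital_map_def semiunital_map_def k_def)
  define X where "X = conj_transpose (\<Phi> B) ** psd_powr A s ** \<Phi> B"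
  define Z where "Z = conj_transpose B ** psd_powr (hs_adjoint \<Phi> A) s ** B"
  have X: "psd X" unfolding X_def using assms by (intro psd_conj psd_psd_powr)
  have Z: "psd Z" unfolding Z_def using assms by (intro psd_conj psd_psd_powr adjoint_psd)
  have "Re (trace (psd_powr X (r / s))) \<le> k powr (1 - r) * Re (trace (psd_powr Z (r / s)))"
  proof (cases "r = s")
    case True
    \<comment> \<open>The exponent \<open>p\<close> is \<open>1\<close> and the dual variable is the identity. The value \<open>s = 1\<close> is an endpoint.\<close>
    have "Re (trace X) \<le> k powr (1 - s) * Re (trace Z)"
    proof (cases "s = 1")
      case True
      then show ?thesis
        using trace_square_le'[OF assms(7), of B] assms(7) k
        by (simp add: X_def Z_def psd_powr_1 adjoint_psd)
    next
      case False
      have one: "psd (mat 1 :: complex ^ 'n ^ 'n)"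
        using psd_real_diag_iff[of "\<lambda>_::'n. 1"] by (simp add: real_diag_1)
      have "psd_powr (mat 1 :: complex ^ 'n ^ 'n) (1 - s) = mat 1"
        using psd_powr_spectral_form[OF unitary_mat_1, of "\<lambda>_::'n. 1" "1 - s"] by (simp add: real_diag_1)
      moreover have "trace (matrix_scale x Z) = x * trace Z" for x
        by (simp add: trace_def matrix_scale_def sum_distrib_left)
      ultimately show ?thesis
        using lieb_monotonicity[OF assms(1) _ assms(7) one, of B] False assms(2) k
        by (simp add: X_def[symmetric] Z_def[symmetric] semi psd_powr_scalar)
    qed
    then show ?thesis using True assms(1) X Z by (simp add: psd_powr_1)
  next
    case False
    then have sr: "s < r" "s < 1" using assms by auto
    define p where "p = r / s"
    define q where "q = r / (r - s)"
    define t where "t = (1 - s) * q"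
    have p: "p > 1" using sr assms by (simp add: p_def)
    have q: "q > 1" using sr assms by (simp add: q_def)
    have pq: "1 / q + 1 / p = 1" using sr assms by (simp add: p_def q_def field_simps)
    have t: "t \<ge> 1"
    proof -
      have "r * s \<le> 1 * s" using assms by (intro mult_right_mono) auto
      then show ?thesis using sr by (simp add: t_def q_def field_simps)
    qed
    obtain U x where U: "unitary U" and x: "\<And>i. x i \<ge> 0" and X_eq: "X = U ** real_diag x ** conj_transpose U"
      using psd_spectral[OF X] by blast
    define C where "C = psd_powr X ((p - 1) / (1 - s))"
    have C_eq: "C = U ** real_diag (\<lambda>i. x i powr ((p - 1) / (1 - s))) ** conj_transpose U"
      using U x by (simp add: C_def X_eq psd_powr_spectral_form)
    have C: "psd C" unfolding C_def by (rule psd_psd_powr[OF X])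
    define \<tau> where "\<tau> = Re (trace (psd_powr X p))"
    have C_s: "psd_powr C (1 - s) = U ** real_diag (\<lambda>i. x i powr (p - 1)) ** conj_transpose U"
      using U sr by (simp add: C_eq psd_powr_spectral_form powr_powr)
    have "(p - 1) * q = p" using pq p q by (simp add: field_simps)
    then have "psd_powr C t = psd_powr X p"
      using U x sr by (simp add: C_eq X_eq psd_powr_spectral_form powr_powr t_def)
    then have C_t: "Re (trace (psd_powr C t)) = \<tau>" by (simp add: \<tau>_def)
    have "\<tau> = Re (trace (psd_powr C (1 - s) ** X))"
    proof -
      have "psd_powr C (1 - s) ** X = U ** (real_diag (\<lambda>i. x i powr (p - 1)) **
          (conj_transpose U ** U) ** real_diag x) ** conj_transpose U"
        unfolding C_s X_eq by (simp add: matrix_mul_assoc)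
      also have "real_diag (\<lambda>i. x i powr (p - 1)) ** (conj_transpose U ** U) ** real_diag x
          = real_diag (\<lambda>i. x i powr p)"
      proof -
        have "x i powr (p - 1) * x i = x i powr p" for i
          using x[of i] p by (cases "x i = 0") (auto simp: powr_diff)
        then show ?thesis
          using U by (simp add: unitary_def real_diag_mult)
      qed
      finally show ?thesis using U x by (simp add: \<tau>_def X_eq psd_powr_spectral_form)
    qed
    also have "\<dots> \<le> Re (trace (psd_powr (hs_adjoint \<Phi> C) (1 - s) ** Z))"
      unfolding X_def Z_def using assms sr C by (intro lieb_monotonicity) auto
    \<comment> \<open>The scaling is chosen such that the factor \<open>k\<^bsup>t-1\<^esup>\<close> from \<open>trace_powr_adjoint_le\<close> cancels.\<close>
    also have "\<dots> \<le> (k powr (- ((1 - r) / p))) powr q *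
          (Re (trace (psd_powr (psd_powr (hs_adjoint \<Phi> C) (1 - s)) q)) / q)
        + (k powr (- ((1 - r) / p))) powr (- p) * (Re (trace (psd_powr Z p)) / p)"
      using p q pq k C Z by (intro trace_young psd_psd_powr adjoint_psd) auto
    also have "(k powr (- ((1 - r) / p))) powr (- p) = k powr (1 - r)"
      using p by (simp add: powr_powr)
    also have "(k powr (- ((1 - r) / p))) powr q = k powr (- (t - 1))"
    proof -
      have "(1 - r) / p * q = t - 1"
        using sr assms by (simp add: p_def q_def t_def field_simps)
      then show ?thesis by (simp add: powr_powr)
    qed
    also have "psd_powr (psd_powr (hs_adjoint \<Phi> C) (1 - s)) q = psd_powr (hs_adjoint \<Phi> C) t"
    proof -
      obtain V y where "unitary V" "\<And>i. y i \<ge> 0" "hs_adjoint \<Phi> C = V ** real_diag y ** conj_transpose V"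
        using psd_spectral[OF adjoint_psd[OF C]] by blast
      then show ?thesis by (simp add: psd_powr_spectral_form powr_powr t_def)
    qed
    finally have "\<tau> \<le> k powr (- (t - 1)) * (Re (trace (psd_powr (hs_adjoint \<Phi> C) t)) / q)
        + k powr (1 - r) * (Re (trace (psd_powr Z p)) / p)" .
    moreover have "k powr (- (t - 1)) * (Re (trace (psd_powr (hs_adjoint \<Phi> C) t)) / q)
        \<le> k powr (- (t - 1)) * (k powr (t - 1) * \<tau> / q)"
      using trace_powr_adjoint_le[OF semi k C t] q
      by (intro mult_left_mono divide_right_mono) (auto simp: C_t)
    moreover have "k powr (- (t - 1)) * (k powr (t - 1) * \<tau> / q) = \<tau> / q"
      using k by (simp flip: mult.assoc powr_add)
    moreover have "\<tau> = \<tau> / q + \<tau> / p"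
      using pq by (metis distrib_left mult.right_neutral times_divide_eq_right)
    ultimately have "\<tau> / p \<le> k powr (1 - r) * (Re (trace (psd_powr Z p)) / p)" by linarith
    then have "\<tau> \<le> k powr (1 - r) * Re (trace (psd_powr Z p))"
      using p by (simp add: pos_divide_le_eq)
    then show ?thesis by (simp add: \<tau>_def p_def)
  qed
  then show ?thesis by (simp add: X_def Z_def k_def)
qed

end
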